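(* Let $S=K\setminus L$ be a Morse tiled finite relative simplicial complex having acyclic $q$-quiver. Then any partial shelling of its $q$-skeleton $S^{(q)}$ induces a spectral sequence which converges to the relative homology $H_*(K^{(q)},L^{(q)};G)$ (resp. relative cohomology $H^*(K^{(q)},L^{(q)};G)$) of its $q$-skeleton with coefficients in any abelian group $G$ and whose first page in gradings less than $q$ is the relative homology (resp. cohomology) of its critical tiles.
   Context: Simplices are closed; an open simplex is the relative interior of a simplex. A finite relative simplicial complex is a complement $S=K\setminus L$, where $L$ is a (possibly empty) subcomplex of a finite simplicial complex $K$; it is regarded as the union of the open simplices of $K$ that are not in $L$, with the topology induced from $K$. Here $q\ge 0$ is an integer, $K^{(q)}$ and $L^{(q)}$ are the $q$-skeletons of $K$ and $L$, and the $q$-skeleton of $S$ is $S^{(q)}=K^{(q)}\setminus L^{(q)}$. Morse tiles: a Morse tile $T$ of dimension $n\ge 0$ and order $k\in\{0,\dots,n+1\}$ is an $n$-simplex $\overline T$ (its underlying simplex) deprived of $k$ of its codimension one faces together with one possibly empty face $\mu$ of higher codimension, called its Morse face; when $\mu$ is non-empty it is understood not to be contained in the removed codimension one faces. The tile is critical of index $k$ iff $\dim\mu=k-1$ (with $\dim\emptyset=-1$); moreover the open $n$-simplex (all codimension one faces removed) is critical of index $n$. The relative homology (resp. cohomology) of a Morse tile $T$ with coefficients in $G$ is $H_*(\overline T,\overline T\setminus T;G)$ (resp. $H^*(\overline T,\overline T\setminus T;G)$). Morse tiling: $S$ is Morse tiled when it is equipped with a partition by Morse tiles such that for every $j\ge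 0$ the union of the tiles of dimension greater than $j$ is closed in $S$. Its critical tiles are the tiles of this partition which are critical. $q$-quiver: the directed graph whose vertices are the tiles of order $\le q+1$ of $S$ and which contains an arrow $T\to T'$, for $T\neq T'$, iff $\overline T\cap T'\cap S^{(q)}\neq\emptyset$. It is acyclic iff it contains no oriented cycle, that is, no path of positive length with same source and target. Partial shelling: a filtration $\emptyset=S_0\subset S_1\cap S^{(q)}\subset\dots\subset S_N\cap S^{(q)}=S^{(q)}$ of $S^{(q)}$ by closed subsets of $S^{(q)}$, where $S_0\subset S_1\subset\dots\subset S_N$ are subsets of $S$ such that for every $j\in\{1,\dots,N\}$, $S_j\setminus S_{j-1}$ consists of a single tile of order $\le q+1$ of $S$. Such a filtration exists when the $q$-quiver is acyclic. *)

theory Defs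
  imports
    "HOL-Analysis.Analysis"
    "HOL-Algebra.Product_Groups"
    "HOL-Library.Function_Algebras"
begin

section \<open>Relative simplicial complexes and Morse tilings\<close>

definition skeleton :: "nat \<Rightarrow> 'a::euclidean_space set set \<Rightarrow> 'a set set" where
  "skeleton q K = {\<sigma> \<in> K. aff_dim \<sigma> \<le> int q}"

definition rel_space :: "'a::euclidean_space set set \<Rightarrow> 'a set set \<Rightarrow> 'a set" where
  "rel_space K L = (\<Union>\<sigma>\<in>K - L. rel_interior \<sigma>)"

text \<open>A tile is kept as data: underlying simplex, set of removed codimension one faces, Morse face.
  The codimension one faces are not expressed by \<^term>\<open>(facet_of)\<close>, because that excludes the empty
  face: a $0$-simplex has one codimension one face, the empty one, so that its orders are $0$ and $1$.\<close>

datatype 'a tile =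
  Tile (underlying: "'a set") (removed_faces: "'a set set") (morse_face: "'a set")

definition tile_points :: "'a tile \<Rightarrow> 'a set" where
  "tile_points T = underlying T - \<Union>(removed_faces T) - morse_face T"

definition tile_dim :: "'a::euclidean_space tile \<Rightarrow> int" where
  "tile_dim T = aff_dim (underlying T)"

definition tile_order :: "'a tile \<Rightarrow> nat" where
  "tile_order T = card (removed_faces T)"

definition morse_tile :: "'a::euclidean_space tile \<Rightarrow> bool" where
  "morse_tile T \<longleftrightarrow>
     (\<exists>n\<ge>0. n simplex underlying T) \<and>
     (\<forall>F\<in>removed_faces T. F face_of underlying T \<and> aff_dim F = tile_dim T - 1) \<and>
     (morse_face T = {} \<or>
        morse_face T face_of underlying T \<and> aff_dim (morse_face T) < tile_dim T - 1 \<and>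
        (\<forall>F\<in>removed_faces T. \<not> morse_face T \<subseteq> F))"

definition critical_of_index :: "'a::euclidean_space tile \<Rightarrow> nat \<Rightarrow> bool" where
  "critical_of_index T k \<longleftrightarrow>
     (tile_order T = k \<and> aff_dim (morse_face T) = int k - 1) \<or>
     (int (tile_order T) = tile_dim T + 1 \<and> tile_dim T = int k)"

definition critical :: "'a::euclidean_space tile \<Rightarrow> bool" where
  "critical T \<longleftrightarrow> (\<exists>k. critical_of_index T k)"

definition morse_tiling ::
  "'a::euclidean_space set set \<Rightarrow> 'a set set \<Rightarrow> 'a tile set \<Rightarrow> bool" where
  "morse_tiling K L P \<longleftrightarrow>
     (\<forall>T\<in>P. morse_tile T \<and> underlying T \<in> K) \<and>
     (\<Union>T\<in>P. tile_points T) = rel_space K L \<and>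
     disjoint_family_on tile_points P \<and>
     (\<forall>j::nat. closedin (top_of_set (rel_space K L))
                 (\<Union>T\<in>{T\<in>P. tile_dim T > int j}. tile_points T))"

definition quiver ::
  "'a::euclidean_space set set \<Rightarrow> 'a set set \<Rightarrow> 'a tile set \<Rightarrow> nat \<Rightarrow> ('a tile \<times> 'a tile) set" where
  "quiver K L P q =
     {(T, T'). T \<in> P \<and> T' \<in> P \<and> tile_order T \<le> q + 1 \<and> tile_order T' \<le> q + 1 \<and> T \<noteq> T' \<and>
        underlying T \<inter> tile_points T' \<inter> rel_space (skeleton q K) (skeleton q L) \<noteq> {}}"

definition partial_shelling ::
  "'a::euclidean_space set set \<Rightarrow> 'a set set \<Rightarrow> 'a tile set \<Rightarrow> nat \<Rightarrow> nat \<Rightarrow> (nat \<Rightarrow> 'a set) \<Rightarrow> bool"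
  where
  "partial_shelling K L P q N S \<longleftrightarrow>
     (let Sq = rel_space (skeleton q K) (skeleton q L) in
       S 0 = {} \<and>
       (\<forall>j\<le>N. S j \<subseteq> rel_space K L) \<and>
       (\<forall>j<N. S j \<subseteq> S (Suc j)) \<and>
       (\<forall>j<N. \<exists>T\<in>P. tile_order T \<le> q + 1 \<and> S (Suc j) - S j = tile_points T) \<and>
       (\<forall>j\<le>N. closedin (top_of_set Sq) (S j \<inter> Sq)) \<and>
       S N \<inter> Sq = Sq)"


section \<open>Relative simplicial homology and cohomology with coefficients\<close>

definition add_group :: "'m::ab_group_add set \<Rightarrow> 'm monoid" where
  "add_group A = \<lparr>carrier = A, monoid.mult = (+), one = 0\<rparr>"

text \<open>Graded complexes with differential of degree \<open>e\<close>: \<open>e = -1\<close> is the homological and \<open>e = 1\<close>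
  the cohomological convention.\<close>

definition homology_of_complex ::
  "int \<Rightarrow> (int \<Rightarrow> 'm::ab_group_add set) \<Rightarrow> ('m \<Rightarrow> 'm) \<Rightarrow> int \<Rightarrow> 'm set monoid" where
  "homology_of_complex e C D n = add_group {x \<in> C n. D x = 0} Mod (D ` C (n - e))"

text \<open>\<open>A\<close> stands for the set \<open>K - L\<close> of simplices of a relative complex. The simplices in \<open>A\<close> form
  a basis of the relative simplicial chains of \<open>(K, L)\<close>, so an \<open>n\<close>-chain with coefficients is a
  function on the \<open>n\<close>-simplices in \<open>A\<close>. An \<open>n\<close>-cochain of \<open>K\<close> vanishing on \<open>L\<close> is such a function
  as well (complexes are finite here). The empty simplex may belong to \<open>A\<close>, but homology is not
  reduced.\<close>

definition simplicial_chains ::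
  "'a::euclidean_space set set \<Rightarrow> int \<Rightarrow> ('a set \<Rightarrow> 'g::ab_group_add) set" where
  "simplicial_chains A n = {c. \<forall>\<sigma>. c \<sigma> \<noteq> 0 \<longrightarrow> \<sigma> \<in> A \<and> \<sigma> \<noteq> {} \<and> aff_dim \<sigma> = n}"

text \<open>Simplices are oriented by a numbering \<open>\<nu>\<close> of the vertices. If \<open>\<tau>\<close> is a facet of \<open>\<sigma>\<close>,
  \<open>omitted_position \<nu> \<sigma> \<tau>\<close> is the position \<open>i\<close>, counted from $0$ in increasing order, of the only
  vertex \<open>w\<close> of \<open>\<sigma>\<close> which is not in \<open>\<tau>\<close>; the incidence number of \<open>\<sigma>\<close> and \<open>\<tau>\<close> is $(-1)^i$.\<close>

definition omitted_position ::
  "('a::euclidean_space \<Rightarrow> nat) \<Rightarrow> 'a set \<Rightarrow> 'a set \<Rightarrow> nat" where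
  "omitted_position \<nu> \<sigma> \<tau> =
     card {u. u extreme_point_of \<tau> \<and> (\<exists>w. w extreme_point_of \<sigma> \<and> w \<notin> \<tau> \<and> \<nu> u < \<nu> w)}"

definition signed :: "nat \<Rightarrow> 'g::ab_group_add \<Rightarrow> 'g" where
  "signed i x = (if even i then x else - x)"

definition simplicial_boundary ::
  "('a::euclidean_space \<Rightarrow> nat) \<Rightarrow> 'a set set \<Rightarrow> ('a set \<Rightarrow> 'g::ab_group_add) \<Rightarrow> 'a set \<Rightarrow> 'g" where
  "simplicial_boundary \<nu> A c \<tau> =
     (if \<tau> \<in> A then \<Sum>\<sigma> | \<sigma> \<in> A \<and> \<tau> facet_of \<sigma>. signed (omitted_position \<nu> \<sigma> \<tau>) (c \<sigma>) else 0)"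

definition simplicial_coboundary ::
  "('a::euclidean_space \<Rightarrow> nat) \<Rightarrow> 'a set set \<Rightarrow> ('a set \<Rightarrow> 'g::ab_group_add) \<Rightarrow> 'a set \<Rightarrow> 'g" where
  "simplicial_coboundary \<nu> A c \<sigma> =
     (if \<sigma> \<in> A then \<Sum>\<tau> | \<tau> \<in> A \<and> \<tau> facet_of \<sigma>. signed (omitted_position \<nu> \<sigma> \<tau>) (c \<tau>) else 0)"

definition simplicial_homology ::
  "'g::ab_group_add itself \<Rightarrow> ('a::euclidean_space \<Rightarrow> nat) \<Rightarrow> 'a set set \<Rightarrow> 'a set set \<Rightarrow> int
     \<Rightarrow> ('a set \<Rightarrow> 'g) set monoid" where
  "simplicial_homology G \<nu> K L =
     homology_of_complex (-1) (simplicial_chains (K - L)) (simplicial_boundary \<nu> (K - L))"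

definition simplicial_cohomology ::
  "'g::ab_group_add itself \<Rightarrow> ('a::euclidean_space \<Rightarrow> nat) \<Rightarrow> 'a set set \<Rightarrow> 'a set set \<Rightarrow> int
     \<Rightarrow> ('a set \<Rightarrow> 'g) set monoid" where
  "simplicial_cohomology G \<nu> K L =
     homology_of_complex 1 (simplicial_chains (K - L)) (simplicial_coboundary \<nu> (K - L))"

text \<open>For a tile \<open>T\<close>, the underlying simplex and its part outside \<open>T\<close> as complexes.\<close>

definition closed_complex :: "'a::euclidean_space tile \<Rightarrow> 'a set set" where
  "closed_complex T = {\<sigma>. \<sigma> face_of underlying T}"

definition removed_complex :: "'a::euclidean_space tile \<Rightarrow> 'a set set" where
  "removed_complex T = {\<sigma>. \<sigma> face_of underlying T \<and> \<sigma> \<subseteq> underlying T - tile_points T}"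

definition tile_homology ::
  "'g::ab_group_add itself \<Rightarrow> ('a::euclidean_space \<Rightarrow> nat) \<Rightarrow> 'a tile \<Rightarrow> int
     \<Rightarrow> ('a set \<Rightarrow> 'g) set monoid" where
  "tile_homology G \<nu> T = simplicial_homology G \<nu> (closed_complex T) (removed_complex T)"

definition tile_cohomology ::
  "'g::ab_group_add itself \<Rightarrow> ('a::euclidean_space \<Rightarrow> nat) \<Rightarrow> 'a tile \<Rightarrow> int
     \<Rightarrow> ('a set \<Rightarrow> 'g) set monoid" where
  "tile_cohomology G \<nu> T = simplicial_cohomology G \<nu> (closed_complex T) (removed_complex T)"


section \<open>Spectral sequences\<close>

text \<open>A page is indexed by the filtration degree \<open>p\<close> and the complementary degree \<open>s\<close>; the total
  degree is \<open>p + s\<close>. For \<open>e = -1\<close> the differential of the page \<open>r\<close> goes from \<open>(p, s)\<close> to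
  \<open>(p - r, s + r - 1)\<close>, for \<open>e = 1\<close> from \<open>(p, s)\<close> to \<open>(p + r, s - r + 1)\<close>.\<close>

definition spectral_sequence ::
  "int \<Rightarrow> (nat \<Rightarrow> int \<Rightarrow> int \<Rightarrow> 'm monoid) \<Rightarrow> (nat \<Rightarrow> int \<Rightarrow> int \<Rightarrow> 'm \<Rightarrow> 'm) \<Rightarrow> bool" where
  "spectral_sequence e E d \<longleftrightarrow>
     (\<forall>r\<ge>1. \<forall>p s.
        (let p' = p + e * int r; s' = s - e * (int r - 1);
             p'' = p - e * int r; s'' = s + e * (int r - 1) in
          comm_group (E r p s) \<and>
          d r p s \<in> hom (E r p s) (E r p' s') \<and>
          (\<forall>x\<in>carrier (E r p s). d r p' s' (d r p s x) = \<one>\<^bsub>E r (p' + e * int r) (s' - e * (int r - 1))\<^esub>) \<and>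
          (E r p s)\<lparr>carrier := kernel (E r p s) (E r p' s') (d r p s)\<rparr>
             Mod (d r p'' s'' ` carrier (E r p'' s''))
            \<cong> E (Suc r) p s))"

text \<open>Convergence: \<open>H n\<close> has a finite filtration \<open>\<Phi> _ n\<close> by subgroups (increasing for \<open>e = -1\<close>,
  decreasing for \<open>e = 1\<close>) whose graded pieces are the stable terms of the spectral sequence.\<close>

definition converges_to ::
  "int \<Rightarrow> (nat \<Rightarrow> int \<Rightarrow> int \<Rightarrow> 'm monoid) \<Rightarrow> (nat \<Rightarrow> int \<Rightarrow> int \<Rightarrow> 'm \<Rightarrow> 'm) \<Rightarrow> (int \<Rightarrow> 'h monoid)
     \<Rightarrow> bool" where
  "converges_to e E d H \<longleftrightarrow>
     (\<exists>\<Phi> :: int \<Rightarrow> int \<Rightarrow> 'h set.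
        (\<forall>n. (\<forall>p. subgroup (\<Phi> p n) (H n) \<and> \<Phi> (p + e) n \<subseteq> \<Phi> p n) \<and>
             (\<exists>p. \<Phi> p n = {\<one>\<^bsub>H n\<^esub>}) \<and> (\<exists>p. \<Phi> p n = carrier (H n))) \<and>
        (\<forall>p s. \<exists>r0\<ge>1. \<forall>r\<ge>r0.
           (let p' = p + e * int r; s' = s - e * (int r - 1);
                p'' = p - e * int r; s'' = s + e * (int r - 1) in
             (\<forall>x\<in>carrier (E r p s). d r p s x = \<one>\<^bsub>E r p' s'\<^esub>) \<and>
             (\<forall>x\<in>carrier (E r p'' s''). d r p'' s'' x = \<one>\<^bsub>E r p s\<^esub>) \<and>
             E r p s \<cong> (H (p + s))\<lparr>carrier := \<Phi> p (p + s)\<rparr> Mod \<Phi> (p + e) (p + s))))"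

text \<open>The spectral sequence of a filtered complex; \<open>F p n\<close> is the filtration step \<open>p\<close> in degree
  \<open>n\<close>, with \<open>F (p + e) n \<subseteq> F p n\<close>. For \<open>e = -1\<close> this is
  $E^r_{p,s} = Z^r_p / (Z^{r-1}_{p-1} + D Z^{r-1}_{p+r-1})$, where
  $Z^r_p = \{x \in F_p \mid D x \in F_{p-r}\}$, with differential induced by \<open>D\<close>.\<close>

definition filtered_cycles ::
  "int \<Rightarrow> (int \<Rightarrow> int \<Rightarrow> 'm::ab_group_add set) \<Rightarrow> ('m \<Rightarrow> 'm) \<Rightarrow> nat \<Rightarrow> int \<Rightarrow> int \<Rightarrow> 'm set" where
  "filtered_cycles e F D r p n = {x \<in> F p n. D x \<in> F (p + e * int r) (n + e)}"

definition filtered_boundaries ::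
  "int \<Rightarrow> (int \<Rightarrow> int \<Rightarrow> 'm::ab_group_add set) \<Rightarrow> ('m \<Rightarrow> 'm) \<Rightarrow> nat \<Rightarrow> int \<Rightarrow> int \<Rightarrow> 'm set" where
  "filtered_boundaries e F D r p n =
     {y + D z | y z. y \<in> filtered_cycles e F D (r - 1) (p + e) n \<and>
                     z \<in> filtered_cycles e F D (r - 1) (p - e * (int r - 1)) (n - e)}"

definition filtration_page ::
  "int \<Rightarrow> (int \<Rightarrow> int \<Rightarrow> 'm::ab_group_add set) \<Rightarrow> ('m \<Rightarrow> 'm) \<Rightarrow> nat \<Rightarrow> int \<Rightarrow> int \<Rightarrow> 'm set monoid" where
  "filtration_page e F D r p s =
     add_group (filtered_cycles e F D r p (p + s)) Mod filtered_boundaries e F D r p (p + s)"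

definition filtration_diff ::
  "int \<Rightarrow> (int \<Rightarrow> int \<Rightarrow> 'm::ab_group_add set) \<Rightarrow> ('m \<Rightarrow> 'm) \<Rightarrow> nat \<Rightarrow> int \<Rightarrow> int \<Rightarrow> 'm set \<Rightarrow> 'm set"
  where
  "filtration_diff e F D r p s X =
     {D x + b | x b. x \<in> X \<and> b \<in> filtered_boundaries e F D r (p + e * int r) (p + s + e)}"


section \<open>The filtrations induced by a partial shelling\<close>

text \<open>The simplices of the \<open>q\<close>-skeleton whose interior lies in the \<open>p\<close>-th step, extended to all
  \<open>p :: int\<close> by the first and the last step. Together with the \<open>q\<close>-skeleton of \<open>L\<close> they form a
  subcomplex \<open>K\<^sub>p\<close> of the \<open>q\<close>-skeleton of \<open>K\<close>.\<close>

definition shelling_simplices ::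
  "'a::euclidean_space set set \<Rightarrow> 'a set set \<Rightarrow> nat \<Rightarrow> nat \<Rightarrow> (nat \<Rightarrow> 'a set) \<Rightarrow> int \<Rightarrow> 'a set set" where
  "shelling_simplices K L q N S p =
     {\<sigma> \<in> skeleton q K - skeleton q L. rel_interior \<sigma> \<subseteq> S (min N (nat p))}"

text \<open>Chains of \<open>K\<^sub>p\<close> relative to the \<open>q\<close>-skeleton of \<open>L\<close>.\<close>

definition chain_filtration ::
  "'a::euclidean_space set set \<Rightarrow> 'a set set \<Rightarrow> nat \<Rightarrow> nat \<Rightarrow> (nat \<Rightarrow> 'a set) \<Rightarrow> int \<Rightarrow> int
     \<Rightarrow> ('a set \<Rightarrow> 'g::ab_group_add) set" where
  "chain_filtration K L q N S p n = simplicial_chains (shelling_simplices K L q N S p) n"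

text \<open>Cochains vanishing on \<open>K\<^bsub>p-1\<^esub>\<close>, so that the term \<open>p\<close> of the first page is the cohomology of
  \<open>(K\<^sub>p, K\<^bsub>p-1\<^esub>)\<close>.\<close>

definition cochain_filtration ::
  "'a::euclidean_space set set \<Rightarrow> 'a set set \<Rightarrow> nat \<Rightarrow> nat \<Rightarrow> (nat \<Rightarrow> 'a set) \<Rightarrow> int \<Rightarrow> int
     \<Rightarrow> ('a set \<Rightarrow> 'g::ab_group_add) set" where
  "cochain_filtration K L q N S p n =
     simplicial_chains
       (skeleton q K - skeleton q L - shelling_simplices K L q N S (p - 1)) n"

definition homology_page ::
  "'g::ab_group_add itself \<Rightarrow> ('a::euclidean_space \<Rightarrow> nat) \<Rightarrow> 'a set set \<Rightarrow> 'a set set \<Rightarrow> nat \<Rightarrow> nat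
     \<Rightarrow> (nat \<Rightarrow> 'a set) \<Rightarrow> nat \<Rightarrow> int \<Rightarrow> int \<Rightarrow> ('a set \<Rightarrow> 'g) set monoid" where
  "homology_page G \<nu> K L q N S =
     filtration_page (-1) (chain_filtration K L q N S)
       (simplicial_boundary \<nu> (skeleton q K - skeleton q L))"

definition homology_diff ::
  "'g::ab_group_add itself \<Rightarrow> ('a::euclidean_space \<Rightarrow> nat) \<Rightarrow> 'a set set \<Rightarrow> 'a set set \<Rightarrow> nat \<Rightarrow> nat
     \<Rightarrow> (nat \<Rightarrow> 'a set) \<Rightarrow> nat \<Rightarrow> int \<Rightarrow> int \<Rightarrow> ('a set \<Rightarrow> 'g) set \<Rightarrow> ('a set \<Rightarrow> 'g) set" where
  "homology_diff G \<nu> K L q N S =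
     filtration_diff (-1) (chain_filtration K L q N S)
       (simplicial_boundary \<nu> (skeleton q K - skeleton q L))"

definition cohomology_page ::
  "'g::ab_group_add itself \<Rightarrow> ('a::euclidean_space \<Rightarrow> nat) \<Rightarrow> 'a set set \<Rightarrow> 'a set set \<Rightarrow> nat \<Rightarrow> nat
     \<Rightarrow> (nat \<Rightarrow> 'a set) \<Rightarrow> nat \<Rightarrow> int \<Rightarrow> int \<Rightarrow> ('a set \<Rightarrow> 'g) set monoid" where
  "cohomology_page G \<nu> K L q N S =
     filtration_page 1 (cochain_filtration K L q N S)
       (simplicial_coboundary \<nu> (skeleton q K - skeleton q L))"

definition cohomology_diff ::
  "'g::ab_group_add itself \<Rightarrow> ('a::euclidean_space \<Rightarrow> nat) \<Rightarrow> 'a set set \<Rightarrow> 'a set set \<Rightarrow> nat \<Rightarrow> nat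
     \<Rightarrow> (nat \<Rightarrow> 'a set) \<Rightarrow> nat \<Rightarrow> int \<Rightarrow> int \<Rightarrow> ('a set \<Rightarrow> 'g) set \<Rightarrow> ('a set \<Rightarrow> 'g) set" where
  "cohomology_diff G \<nu> K L q N S =
     filtration_diff 1 (cochain_filtration K L q N S)
       (simplicial_coboundary \<nu> (skeleton q K - skeleton q L))"

text \<open>The critical tiles of the tiling added at step \<open>p\<close>: at most one, and none unless
  \<open>1 \<le> p \<le> N\<close>.\<close>

definition critical_tiles_at ::
  "'a::euclidean_space tile set \<Rightarrow> nat \<Rightarrow> (nat \<Rightarrow> 'a set) \<Rightarrow> int \<Rightarrow> 'a tile set" where
  "critical_tiles_at P N S p =
     {T \<in> P. critical T \<and> 1 \<le> p \<and> p \<le> int N \<and> tile_points T = S (nat p) - S (nat p - 1)}"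

text \<open>In total degrees \<open>n < q\<close>, the page \<open>E1\<close> is the (co)homology \<open>h\<close> of the critical tiles: term by
  term for the tile added at step \<open>p\<close>, and as a whole for all the critical tiles of the tiling (a
  tile which never occurs in the partial shelling is thus accounted for as well).\<close>

definition page_of_critical_tiles ::
  "'a::euclidean_space tile set \<Rightarrow> nat \<Rightarrow> nat \<Rightarrow> (nat \<Rightarrow> 'a set) \<Rightarrow> (int \<Rightarrow> int \<Rightarrow> 'm monoid)
     \<Rightarrow> ('a tile \<Rightarrow> int \<Rightarrow> 'h monoid) \<Rightarrow> bool" where
  "page_of_critical_tiles P q N S E1 h \<longleftrightarrow>
     (\<forall>n < int q.
        (\<forall>p. E1 p (n - p) \<cong> sum_group (critical_tiles_at P N S p) (\<lambda>T. h T n)) \<and>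
        sum_group UNIV (\<lambda>p. E1 p (n - p)) \<cong> sum_group {T \<in> P. critical T} (\<lambda>T. h T n))"

end

theory Submission
  imports Defs
begin

text \<open>The partial shelling filters the relative chain complex of the skeleton by the simplices whose
  interior lies in the steps of the shelling; these are subcomplexes because the steps are closed in
  the skeleton. The filtration is finite, so its spectral sequence converges. Since tiles are unions of
  open simplices, the graded piece of the filtration at step \<open>p\<close> is spanned by the simplices of
  dimension at most \<open>q\<close> of the tile added at this step, so that in degrees less than \<open>q\<close> the first page
  is the homology of that tile. A tile which is not critical has no homology: it is stable under adding
  and deleting a suitable vertex. Boundary and coboundary are treated simultaneously, as differentials of
  degree \<open>e = -1\<close> and \<open>e = 1\<close>.\<close>

section \<open>Quotients of additive groups\<close>

text \<open>Two different complexes meet at a step of the shelling: the page sees only the simplices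
  of dimension at most \<open>q\<close> of the tile, while the homology of the tile uses all of
  them. Homology in degree \<open>n\<close> depends on the dimensions \<open>n - 1\<close>,
  \<open>n\<close> and \<open>n + 1\<close> only, so the two agree when
  \<open>n + 1 \<le> q\<close>; this is the source of the bound on the degrees. The vanishing for a
  tile that is not critical comes from a perfect matching of its simplices, \<open>\<sigma>\<close>
  with \<open>\<sigma>\<close> plus a fixed vertex. Between the matched halves the differential is a
  signed permutation matrix, which is invertible over every coefficient group. One proof serves
  boundary and coboundary because both filtrations consist of the chains supported on families of
  simplices stable under the differential: subcomplexes in one case, complements of subcomplexes in
  the other. The direction of the filtration is tied to the degree \<open>e\<close> of the
  differential. All cycles, boundaries and filtration steps are subgroups of one function space, so
  the quotients are compared on representatives.\<close>

lemma (in group_hom) FactGroup_iso_FactGroup: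
  assumes M: "M \<lhd> H" and N: "N = {x \<in> carrier G. h x \<in> M}"
    and onto: "\<And>y. y \<in> carrier H \<Longrightarrow> \<exists>x\<in>carrier G. M #>\<^bsub>H\<^esub> y = M #>\<^bsub>H\<^esub> h x"
  shows "G Mod N \<cong> H Mod M"
proof -
  interpret M: normal M H by fact
  \<comment> \<open>The first isomorphism theorem is applied to \<open>h\<close> followed by the
    projection to \<open>H Mod M\<close>; the kernel of this composite is \<open>N\<close>.\<close>
  let ?k = "\<lambda>x. M #>\<^bsub>H\<^esub> h x"
  have "group_hom G (H Mod M) ?k"
  proof (intro group_hom.intro group_hom_axioms.intro)
    have "(\<lambda>a. M #>\<^bsub>H\<^esub> a) \<circ> h \<in> hom G (H Mod M)"
      using homh M.r_coset_hom_Mod by (rule Group.hom_compose)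
    then show "?k \<in> hom G (H Mod M)"
      by (simp add: comp_def)
  qed (auto simp: M.factorgroup_is_group)
  then interpret k: group_hom G "H Mod M" ?k .
  have ker: "M #>\<^bsub>H\<^esub> y = M \<longleftrightarrow> y \<in> M" if "y \<in> carrier H" for y
    using that H.coset_join1[OF _ that M.subgroup_axioms] H.coset_join2[OF that M.subgroup_axioms]
    by (auto simp: M.subset)
  have "kernel G (H Mod M) ?k = N"
    unfolding kernel_def N by (simp add: ker cong: conj_cong)
  moreover have "?k ` carrier G = carrier (H Mod M)"
    using onto by (fastforce simp: carrier_FactGroup)
  ultimately show ?thesis
    using k.FactGroup_iso by simp
qed

text \<open>The one-step subgroup test inside the additive group of the type: it avoids carriers and
  inverses as long as only elements are handled.\<close>

definition diff_closed :: "'m::ab_group_add set \<Rightarrow> bool" where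
  "diff_closed A \<longleftrightarrow> 0 \<in> A \<and> (\<forall>x\<in>A. \<forall>y\<in>A. x - y \<in> A)"

text \<open>The right coset \<open>B #> x\<close>, freed from the ambient monoid record, so that it
  stays the same when the carrier changes.\<close>

definition coset :: "'m::ab_group_add set \<Rightarrow> 'm \<Rightarrow> 'm set" where
  "coset B x = {b + x | b. b \<in> B}"

lemma diff_closed_zero: "diff_closed A \<Longrightarrow> 0 \<in> A"
  and diff_closed_diff: "diff_closed A \<Longrightarrow> x \<in> A \<Longrightarrow> y \<in> A \<Longrightarrow> x - y \<in> A"
  by (auto simp: diff_closed_def)

lemma diff_closed_uminus: "diff_closed A \<Longrightarrow> x \<in> A \<Longrightarrow> - x \<in> A"
  by (metis diff_0 diff_closed_def)

lemma diff_closed_add: "diff_closed A \<Longrightarrow> x \<in> A \<Longrightarrow> y \<in> A \<Longrightarrow> x + y \<in> A"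
  by (metis diff_closed_diff diff_closed_uminus diff_minus_eq_add)

lemma diff_closed_image:
  assumes "diff_closed A" and "Modules.additive f"
  shows "diff_closed (f ` A)"
  using assms by (auto simp: diff_closed_def additive.zero image_iff) (metis additive.diff additive.zero)+

lemma diff_closed_sum:
  assumes "diff_closed A" "diff_closed B"
  shows "diff_closed {x + y | x y. x \<in> A \<and> y \<in> B}"
  unfolding diff_closed_def
proof (safe, goal_cases)
  case 1
  show ?case using assms by (auto simp: diff_closed_def intro!: exI[of _ 0])
next
  case (2 _ _ a b c d)
  then show ?case
    using assms by (intro exI[of _ "a - b"] exI[of _ "c - d"]) (auto simp: diff_closed_def)
qed

lemma coset_eq_iff:
  assumes "diff_closed B"
  shows "coset B x = coset B y \<longleftrightarrow> x - y \<in> B"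
proof
  assume "coset B x = coset B y"
  moreover have "x \<in> coset B x"
    using diff_closed_zero[OF assms] by (auto simp: coset_def intro!: exI[of _ 0])
  ultimately show "x - y \<in> B" by (auto simp: coset_def)
next
  assume xy: "x - y \<in> B"
  show "coset B x = coset B y"
  proof (safe)
    fix z assume "z \<in> coset B x"
    then obtain b where "b \<in> B" "z = b + x" by (auto simp: coset_def)
    then show "z \<in> coset B y"
      using diff_closed_add[OF assms _ xy] by (auto simp: coset_def intro!: exI[of _ "b + (x - y)"])
  next
    fix z assume "z \<in> coset B y"
    then obtain b where "b \<in> B" "z = b + y" by (auto simp: coset_def)
    then show "z \<in> coset B x"
      using diff_closed_diff[OF assms _ xy] by (auto simp: coset_def intro!: exI[of _ "b - (x - y)"])
  qed
qed

lemma coset_zero: "coset B 0 = B"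
  by (simp add: coset_def)

lemma coset_eq_self_iff: "diff_closed B \<Longrightarrow> coset B x = B \<longleftrightarrow> x \<in> B"
  using coset_eq_iff[of B x 0] by (simp add: coset_zero)

lemma coset_image_self: "diff_closed B \<Longrightarrow> coset B ` B = {B}"
  using coset_eq_self_iff[of B] diff_closed_zero[of B] by (metis image_cong image_constant)

section \<open>Additive subsets as groups, and their quotient groups\<close>

lemma carrier_add_group [simp]: "carrier (add_group A) = A"
  and mult_add_group [simp]: "x \<otimes>\<^bsub>add_group A\<^esub> y = x + y"
  and one_add_group [simp]: "\<one>\<^bsub>add_group A\<^esub> = 0"
  by (simp_all add: add_group_def)

lemma r_coset_add_group [simp]: "B #>\<^bsub>add_group A\<^esub> x = coset B x"
  by (auto simp: r_coset_def coset_def)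

lemma comm_group_add_group:
  assumes "diff_closed A"
  shows "comm_group (add_group A)"
proof (rule comm_groupI)
  fix x assume "x \<in> carrier (add_group A)"
  then show "\<exists>y\<in>carrier (add_group A). y \<otimes>\<^bsub>add_group A\<^esub> x = \<one>\<^bsub>add_group A\<^esub>"
    using diff_closed_uminus[OF assms] by (intro bexI[of _ "- x"]) auto
qed (auto simp: assms diff_closed_zero diff_closed_add add.assoc add.commute)

lemma subgroup_add_group:
  assumes "diff_closed A" "diff_closed B" "B \<subseteq> A"
  shows "subgroup B (add_group A)"
proof -
  interpret comm_group "add_group A" using assms(1) by (rule comm_group_add_group)
  have "inv\<^bsub>add_group A\<^esub> x = - x" if "x \<in> A" for x
    using that diff_closed_uminus[OF assms(1)] by (intro inv_equality) auto
  then show ?thesis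
    using assms by (intro subgroupI)
      (auto simp: diff_closed_add diff_closed_uminus dest: diff_closed_zero)
qed

lemma normal_add_group:
  "diff_closed A \<Longrightarrow> diff_closed B \<Longrightarrow> B \<subseteq> A \<Longrightarrow> B \<lhd> add_group A"
  by (simp add: comm_group.normal_iff_subgroup comm_group_add_group subgroup_add_group)

lemma comm_group_add_group_Mod:
  "diff_closed A \<Longrightarrow> diff_closed B \<Longrightarrow> B \<subseteq> A \<Longrightarrow> comm_group (add_group A Mod B)"
  by (simp add: comm_group.abelian_FactGroup comm_group_add_group subgroup_add_group)

lemma carrier_add_group_Mod: "carrier (add_group A Mod B) = coset B ` A"
  by (simp add: carrier_FactGroup)

lemma set_mult_coset:
  assumes "diff_closed A" "diff_closed B" "B \<subseteq> A" "x \<in> A" "y \<in> A"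
  shows "coset B x <#>\<^bsub>add_group A\<^esub> coset B y = coset B (x + y)"
  using normal.rcos_sum[OF normal_add_group[OF assms(1-3)], of x y] assms(4,5) by simp

text \<open>The tool for comparing subquotients by a map on representatives. Kernel and surjectivity
  are required only modulo \<open>B'\<close>; with the identity for \<open>f\<close> it compares a
  subgroup with a larger one having the same classes.\<close>

lemma add_group_Mod_iso:
  assumes A: "diff_closed A" and B: "diff_closed B" "B \<subseteq> A"
    and A': "diff_closed A'" and B': "diff_closed B'" "B' \<subseteq> A'"
    and f: "\<And>x y. x \<in> A \<Longrightarrow> y \<in> A \<Longrightarrow> f (x + y) = f x + f y" "\<And>x. x \<in> A \<Longrightarrow> f x \<in> A'"
    and ker: "\<And>x. x \<in> A \<Longrightarrow> f x \<in> B' \<longleftrightarrow> x \<in> B"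
    and onto: "\<And>y. y \<in> A' \<Longrightarrow> \<exists>x\<in>A. y - f x \<in> B'"
  shows "add_group A Mod B \<cong> add_group A' Mod B'"
proof -
  interpret group_hom "add_group A" "add_group A'" f
    using comm_group_add_group[OF A] comm_group_add_group[OF A'] f
    by (auto simp: group_hom_def group_hom_axioms_def hom_def comm_group_def)
  show ?thesis
  proof (rule FactGroup_iso_FactGroup)
    show "B' \<lhd> add_group A'"
      by (simp add: A' B' normal_add_group)
  qed (use assms in \<open>auto simp: coset_eq_iff\<close>)
qed

text \<open>The third isomorphism theorem, with \<open>X\<close> modulo \<open>B\<close> in the
  record update form in which \<open>spectral_sequence\<close> and \<open>converges_to\<close> state
  kernels and filtration steps. The first direction serves the next page, the second the graded
  pieces of the limit.\<close>

lemma Mod_Mod_iso: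
  assumes Z: "diff_closed Z" and B: "diff_closed B" and X: "diff_closed X" and Y: "diff_closed Y"
    and sub: "B \<subseteq> Y" "Y \<subseteq> X" "X \<subseteq> Z"
  shows "(add_group Z Mod B)\<lparr>carrier := coset B ` X\<rparr> Mod (coset B ` Y) \<cong> add_group X Mod Y"
    and "add_group X Mod Y \<cong> (add_group Z Mod B)\<lparr>carrier := coset B ` X\<rparr> Mod (coset B ` Y)"
    and "subgroup (coset B ` X) (add_group Z Mod B)"
proof -
  let ?Q = "add_group Z Mod B"
  interpret Q: comm_group ?Q
    using Z B sub by (intro comm_group_add_group_Mod) auto
  have mult: "coset B x <#>\<^bsub>add_group Z\<^esub> coset B y = coset B (x + y)" if "x \<in> Z" "y \<in> Z" for x y
    using Z B sub that by (intro set_mult_coset) auto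
  have inv: "inv\<^bsub>?Q\<^esub> (coset B x) = coset B (- x)" if "x \<in> Z" for x
    using that diff_closed_uminus[OF Z that]
    by (intro Q.inv_equality) (auto simp: mult carrier_add_group_Mod coset_zero)
  \<comment> \<open>Here \<open>X\<close> is bound anew, since the fact is needed for both
    \<open>X\<close> and \<open>Y\<close>.\<close>
  have sg: "subgroup (coset B ` X) ?Q" if "X \<subseteq> Z" "diff_closed X" for X
  proof (rule Q.subgroupI)
    show "coset B ` X \<subseteq> carrier ?Q" "coset B ` X \<noteq> {}"
      using that diff_closed_zero by (auto simp: carrier_add_group_Mod)
    fix a assume "a \<in> coset B ` X"
    then obtain x where x: "x \<in> X" "a = coset B x" by blast
    then show "inv\<^bsub>?Q\<^esub> a \<in> coset B ` X"
      using that diff_closed_uminus[OF that(2)] by (auto simp: inv subset_iff)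
    fix b assume "b \<in> coset B ` X"
    then obtain y where y: "y \<in> X" "b = coset B y" by blast
    show "a \<otimes>\<^bsub>?Q\<^esub> b \<in> coset B ` X"
      using that x y diff_closed_add[OF that(2)] by (auto simp: mult subset_iff)
  qed
  from sg[OF sub(3) X] show "subgroup (coset B ` X) ?Q" .
  let ?H = "?Q\<lparr>carrier := coset B ` X\<rparr>"
  interpret H: comm_group ?H
  proof (rule group.group_comm_groupI)
    show "group ?H" by (rule Q.subgroup_imp_group[OF sg[OF sub(3) X]])
    show "x \<otimes>\<^bsub>?H\<^esub> y = y \<otimes>\<^bsub>?H\<^esub> x" if "x \<in> carrier ?H" "y \<in> carrier ?H" for x y
      using that sg[OF sub(3) X, THEN subgroup.subset] Q.m_comm[of x y] by (simp add: subset_iff)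
  qed
  interpret group_hom "add_group X" ?H "coset B"
    using comm_group_add_group[OF X] H.is_group sub mult
    by (auto simp: group_hom_def group_hom_axioms_def hom_def comm_group_def subset_iff)
  have nor: "coset B ` Y \<lhd> ?H"
    unfolding H.normal_iff_subgroup
    using sg[OF _ Y] sg[OF _ X] sub
    by (intro Q.subgroup_incl) auto
  show iso: "add_group X Mod Y \<cong> ?H Mod (coset B ` Y)"
  proof (rule FactGroup_iso_FactGroup[OF nor])
    show "Y = {x \<in> carrier (add_group X). coset B x \<in> coset B ` Y}"
    proof (safe, goal_cases)
      case (3 x y)
      then have "x - y \<in> Y" using B sub by (auto simp: coset_eq_iff)
      then show "x \<in> Y" using diff_closed_add[OF Y _ 3(3), of "x - y"] by simp
    qed (use sub in auto)
  qed auto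
  from iso show "?H Mod (coset B ` Y) \<cong> add_group X Mod Y"
    by (rule group.iso_sym[rotated]) (use comm_group_add_group_Mod X Y sub in \<open>auto simp: comm_group_def\<close>)
qed

section \<open>The spectral sequence of a filtered complex\<close>

text \<open>Moving the filtration index by \<open>e\<close> shrinks the step: the filtration
  increases with \<open>p\<close> for \<open>e = -1\<close> and decreases for \<open>e = 1\<close>.
  Thus one set of formulas covers both conventions.\<close>

locale filtered_complex =
  fixes e :: int and F :: "int \<Rightarrow> int \<Rightarrow> 'm::ab_group_add set" and D :: "'m \<Rightarrow> 'm"
  assumes diff_closed_F: "diff_closed (F p n)"
    and F_decreasing: "F (p + e) n \<subseteq> F p n"
    and additive_D: "Modules.additive D"
    and D_F: "x \<in> F p n \<Longrightarrow> D x \<in> F p (n + e)"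
    and D_D: "D (D x) = 0"
begin

abbreviation "Z \<equiv> filtered_cycles e F D"
abbreviation "B \<equiv> filtered_boundaries e F D"
abbreviation "E \<equiv> filtration_page e F D"
abbreviation "d \<equiv> filtration_diff e F D"

lemmas D_add = additive.add[OF additive_D]
lemmas D_diff = additive.diff[OF additive_D]
lemmas D_zero = additive.zero[OF additive_D]

lemmas F_diff = diff_closed_diff[OF diff_closed_F]
lemmas F_zero = diff_closed_zero[OF diff_closed_F]

lemma F_decreasing_mult: "F (p + e * int k) n \<subseteq> F p n"
proof (induction k)
  case (Suc k)
  have "F (p + e * int (Suc k)) n \<subseteq> F (p + e * int k) n"
    using F_decreasing[of "p + e * int k" n] by (simp add: algebra_simps)
  then show ?case using Suc by blast
qed simp

lemma F_mono: "x \<in> F p' n \<Longrightarrow> p' = p + e * int k \<Longrightarrow> x \<in> F p n"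
  using F_decreasing_mult by blast

lemma Z_iff: "x \<in> Z r p n \<longleftrightarrow> x \<in> F p n \<and> D x \<in> F (p + e * int r) (n + e)"
  by (simp add: filtered_cycles_def)

lemma diff_closed_Z: "diff_closed (Z r p n)"
  using diff_closed_F by (auto simp: diff_closed_def Z_iff D_diff D_zero)

lemma B_iff:
  "x \<in> B r p n \<longleftrightarrow> (\<exists>y z. x = y + D z \<and> y \<in> Z (r - 1) (p + e) n \<and>
     z \<in> Z (r - 1) (p - e * (int r - 1)) (n - e))"
  by (auto simp: filtered_boundaries_def)

lemma diff_closed_B: "diff_closed (B r p n)"
proof -
  have "B r p n = {y + w | y w. y \<in> Z (r - 1) (p + e) n \<and>
     w \<in> D ` Z (r - 1) (p - e * (int r - 1)) (n - e)}"
    by (auto simp: filtered_boundaries_def)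
  then show ?thesis
    by (simp add: diff_closed_sum diff_closed_image diff_closed_Z additive_D)
qed

lemmas Z_add = diff_closed_add[OF diff_closed_Z]
lemmas Z_zero = diff_closed_zero[OF diff_closed_Z]
lemmas B_zero = diff_closed_zero[OF diff_closed_B]
lemmas B_add = diff_closed_add[OF diff_closed_B]

text \<open>Both sides ask \<open>D x\<close> to lie in the same filtration step, as
  \<open>(p + e) + e * k = p + e * (k + 1)\<close>.\<close>

lemma Z_Suc_shift: "x \<in> Z k (p + e) n \<Longrightarrow> x \<in> Z (Suc k) p n"
  using F_decreasing[of p n] by (auto simp: Z_iff algebra_simps)

lemma Z_mono: "x \<in> Z (Suc k) p n \<Longrightarrow> x \<in> Z k p n"
  using F_mono[of "D x" "p + e * int (Suc k)" "n + e" "p + e * int k" 1]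
  by (auto simp: Z_iff algebra_simps)

lemma B_subset_Z:
  assumes "r \<ge> 1" shows "B r p n \<subseteq> Z r p n"
proof
  fix x assume "x \<in> B r p n"
  then obtain y z where x: "x = y + D z" and y: "y \<in> Z (r - 1) (p + e) n"
    and z: "z \<in> Z (r - 1) (p - e * (int r - 1)) (n - e)" by (auto simp: B_iff)
  have "y \<in> Z r p n" using Z_Suc_shift[OF y] assms by simp
  moreover have "D z \<in> Z r p n"
    using z assms by (simp add: Z_iff D_D F_zero of_nat_diff)
  ultimately show "x \<in> Z r p n" unfolding x by (rule Z_add)
qed

lemma B_I1: "y \<in> Z (r - 1) (p + e) n \<Longrightarrow> y \<in> B r p n"
  unfolding B_iff by (rule exI[of _ y], rule exI[of _ 0]) (simp add: D_zero Z_zero)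

lemma B_I2: "z \<in> Z (r - 1) (p - e * (int r - 1)) (n - e) \<Longrightarrow> D z \<in> B r p n"
  unfolding B_iff by (rule exI[of _ 0], rule exI[of _ z]) (simp add: Z_zero)

lemma B_Suc_I: "y \<in> Z r (p + e) n \<Longrightarrow> z \<in> Z r (p - e * int r) (n - e) \<Longrightarrow> y + D z \<in> B (Suc r) p n"
  unfolding B_iff by (rule exI[of _ y], rule exI[of _ z]) simp

text \<open>The order \<open>r'\<close> is arbitrary because \<open>D x\<close> is a genuine
  cycle.\<close>

lemma D_Z: "x \<in> Z r p n \<Longrightarrow> D x \<in> Z r' (p + e * int r) (n + e)"
  by (simp add: Z_iff D_D F_zero)

text \<open>The summand \<open>D z\<close> of a boundary is killed. The other summand
  \<open>y\<close> lies in step \<open>p + e\<close>, which is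
  \<open>(p + e * r) - e * (r - 1)\<close>, exactly where the target allows boundaries to come
  from.\<close>

lemma D_B:
  assumes "r \<ge> 1" "b \<in> B r p n" shows "D b \<in> B r (p + e * int r) (n + e)"
proof -
  obtain y z where b: "b = y + D z" and y: "y \<in> Z (r - 1) (p + e) n"
    using assms by (auto simp: B_iff)
  have "D y \<in> B r (p + e * int r) (n + e)"
    using y assms by (intro B_I2) (simp add: algebra_simps of_nat_diff)
  then show ?thesis by (simp add: b D_add D_D)
qed

section \<open>The pages and their differentials\<close>

lemma page_eq: "E r p s = add_group (Z r p (p + s)) Mod B r p (p + s)"
  by (simp add: filtration_page_def)

lemma comm_group_page: "r \<ge> 1 \<Longrightarrow> comm_group (E r p s)"
  by (simp add: page_eq comm_group_add_group_Mod diff_closed_Z diff_closed_B B_subset_Z)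

text \<open>Boundaries go to boundaries by \<open>D_B\<close>, so adding all boundaries of the
  target in \<open>filtration_diff\<close> fills up one coset and nothing more.\<close>

lemma diff_coset:
  assumes "r \<ge> 1"
  shows "d r p s (coset (B r p (p + s)) x) = coset (B r (p + e * int r) (p + s + e)) (D x)"
proof -
  let ?B = "B r p (p + s)" and ?B' = "B r (p + e * int r) (p + s + e)"
  have eq: "d r p s (coset ?B x) = {D (b + x) + b' | b b'. b \<in> ?B \<and> b' \<in> ?B'}"
    unfolding filtration_diff_def coset_def by blast
  show ?thesis
    unfolding eq
  proof (intro equalityI subsetI)
    fix z assume "z \<in> {D (b + x) + b' | b b'. b \<in> ?B \<and> b' \<in> ?B'}"
    then obtain b b' where z: "z = D (b + x) + b'" and b: "b \<in> ?B" "b' \<in> ?B'" by blast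
    have "z = (D b + b') + D x" by (simp add: z D_add algebra_simps)
    moreover have "D b + b' \<in> ?B'" using D_B[OF assms b(1)] b(2) by (rule B_add)
    ultimately show "z \<in> coset ?B' (D x)" unfolding coset_def by blast
  next
    fix z assume "z \<in> coset ?B' (D x)"
    then obtain b' where z: "z = b' + D x" and b': "b' \<in> ?B'" unfolding coset_def by blast
    have "z = D (0 + x) + b'" by (simp add: z algebra_simps)
    then show "z \<in> {D (b + x) + b' | b b'. b \<in> ?B \<and> b' \<in> ?B'}"
      using b' B_zero[of r p "p + s"] by blast
  qed
qed

text \<open>The homology of the page \<open>r\<close> is rewritten as a quotient \<open>X\<close> by
  \<open>Y\<close> of groups of representatives, and the inclusion of \<open>Z (Suc r) p n\<close>
  into \<open>X\<close> then induces the isomorphism with the next page.\<close>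

lemma spectral_sequence_filtration: "spectral_sequence e E d"
proof -
  have step: "comm_group (E r p s) \<and>
      d r p s \<in> hom (E r p s) (E r p' s') \<and>
      (\<forall>x\<in>carrier (E r p s). d r p' s' (d r p s x) = \<one>\<^bsub>E r (p' + e * int r) (s' - e * (int r - 1))\<^esub>) \<and>
      (E r p s)\<lparr>carrier := kernel (E r p s) (E r p' s') (d r p s)\<rparr>
         Mod (d r p'' s'' ` carrier (E r p'' s''))
        \<cong> E (Suc r) p s"
    if r: "r \<ge> 1" and p': "p' = p + e * int r" and s': "s' = s - e * (int r - 1)"
      and p'': "p'' = p - e * int r" and s'': "s'' = s + e * (int r - 1)" for r p s p' s' p'' s''
  proof (intro conjI ballI)
    define n where "n = p + s"
    have deg: "p' + s' = n + e" "p'' + s'' = n - e" "p' + e * int r + (s' - e * (int r - 1)) = n + e + e"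
      by (simp_all add: n_def p' s' p'' s'' algebra_simps)
    have d1: "d r p s (coset (B r p n) x) = coset (B r p' (n + e)) (D x)" for x
      using diff_coset[OF r, of p s x] by (simp add: n_def p')
    have d2: "d r p'' s'' (coset (B r p'' (n - e)) x) = coset (B r p n) (D x)" for x
      using diff_coset[OF r, of p'' s'' x] unfolding deg by (simp add: p'')
    have d3: "d r p' s' (coset (B r p' (n + e)) x) = coset (B r (p' + e * int r) (n + e + e)) (D x)" for x
      using diff_coset[OF r, of p' s' x] unfolding deg by simp
    have E: "E r p s = add_group (Z r p n) Mod B r p n"
        "E r p' s' = add_group (Z r p' (n + e)) Mod B r p' (n + e)"
        "E r p'' s'' = add_group (Z r p'' (n - e)) Mod B r p'' (n - e)"
        "E (Suc r) p s = add_group (Z (Suc r) p n) Mod B (Suc r) p n"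
      unfolding page_eq deg n_def by simp_all
    have one: "\<one>\<^bsub>E r (p' + e * int r) (s' - e * (int r - 1))\<^esub> = B r (p' + e * int r) (n + e + e)"
      unfolding page_eq deg by simp
    note car = carrier_add_group_Mod
    have DZ: "D x \<in> Z r p' (n + e)" if "x \<in> Z r p n" for x
      using D_Z[OF that] by (simp add: p')
    show "comm_group (E r p s)" by (rule comm_group_page[OF r])
    show "d r p s \<in> hom (E r p s) (E r p' s')"
      using DZ B_subset_Z[OF r]
      by (auto simp: hom_def car E d1 set_mult_coset diff_closed_Z diff_closed_B D_add Z_add)
    show "d r p' s' (d r p s x) = \<one>\<^bsub>E r (p' + e * int r) (s' - e * (int r - 1))\<^esub>"
      if "x \<in> carrier (E r p s)" for x
      using that by (auto simp: car E one d1 d3 D_D coset_zero)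
    \<comment> \<open>\<open>X\<close> and \<open>Y\<close> are the preimages in
      \<open>Z r p n\<close> of the kernel of the outgoing and of the image of the incoming
      differential.\<close>
    define X where "X = {x \<in> Z r p n. D x \<in> B r p' (n + e)}"
    define Y where "Y = {b + w | b w. b \<in> B r p n \<and> w \<in> D ` Z r p'' (n - e)}"
    have X: "diff_closed X"
      using diff_closed_Z diff_closed_B by (auto simp: X_def diff_closed_def D_diff D_zero)
    have Y: "diff_closed Y"
      unfolding Y_def by (intro diff_closed_sum diff_closed_B diff_closed_image diff_closed_Z additive_D)
    have "{a \<in> coset (B r p n) ` Z r p n. d r p s a = B r p' (n + e)} = coset (B r p n) ` X"
    proof -
      have "d r p s (coset (B r p n) x) = B r p' (n + e) \<longleftrightarrow> D x \<in> B r p' (n + e)" for x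
        unfolding d1 by (rule coset_eq_self_iff[OF diff_closed_B])
      then show ?thesis unfolding X_def by blast
    qed
    then have ker: "kernel (E r p s) (E r p' s') (d r p s) = coset (B r p n) ` X"
      unfolding kernel_def car E by (simp only: one_FactGroup)
    have im: "d r p'' s'' ` carrier (E r p'' s'') = coset (B r p n) ` Y"
    proof (safe)
      fix x assume "x \<in> carrier (E r p'' s'')"
      then obtain z where "z \<in> Z r p'' (n - e)" and "x = coset (B r p'' (n - e)) z"
        by (auto simp: car E)
      moreover have "D z \<in> Y"
        unfolding Y_def using calculation B_zero by force
      ultimately show "d r p'' s'' x \<in> coset (B r p n) ` Y"
        by (simp add: d2)
    next
      fix y assume "y \<in> Y"
      then obtain b z where y: "y = b + D z" and b: "b \<in> B r p n" and z: "z \<in> Z r p'' (n - e)"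
        by (auto simp: Y_def)
      have "coset (B r p n) y = d r p'' s'' (coset (B r p'' (n - e)) z)"
        using b by (simp add: d2 y coset_eq_iff diff_closed_B)
      then show "coset (B r p n) y \<in> d r p'' s'' ` carrier (E r p'' s'')"
        using z by (auto simp: car E)
    qed
    have BY: "B r p n \<subseteq> Y"
      unfolding Y_def using Z_zero D_zero by force
    have YX: "Y \<subseteq> X"
    proof
      fix y assume "y \<in> Y"
      then obtain b z where y: "y = b + D z" and b: "b \<in> B r p n" and z: "z \<in> Z r p'' (n - e)"
        by (auto simp: Y_def)
      have "b \<in> Z r p n" using b B_subset_Z[OF r] by blast
      moreover have "D z \<in> Z r p n" using D_Z[OF z, of r] by (simp add: p'')
      moreover have "D y \<in> B r p' (n + e)"
        using D_B[OF r b] by (simp add: y D_add D_D p')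
      ultimately show "y \<in> X" by (simp add: X_def y Z_add)
    qed
    have "(E r p s)\<lparr>carrier := coset (B r p n) ` X\<rparr> Mod (coset (B r p n) ` Y) \<cong> add_group X Mod Y"
      unfolding E
      using BY YX by (intro Mod_Mod_iso diff_closed_Z diff_closed_B X Y) (auto simp: X_def)
    also have "add_group X Mod Y \<cong> E (Suc r) p s"
    proof (rule group.iso_sym)
      show "group (E (Suc r) p s)"
        using comm_group_page[of "Suc r"] by (simp add: comm_group_def)
      show "E (Suc r) p s \<cong> add_group X Mod Y"
        unfolding E
      proof (rule add_group_Mod_iso[where f = "\<lambda>x. x"])
        fix x assume x: "x \<in> Z (Suc r) p n"
        \<comment> \<open>One more order of vanishing puts \<open>D x\<close> into the summand of
          the boundaries that comes from the next filtration step.\<close>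
        have "D x \<in> Z (r - 1) (p' + e) (n + e)"
          using x r by (simp add: Z_iff D_D F_zero p' algebra_simps)
        then show "x \<in> X" using Z_mono[OF x] by (simp add: X_def B_I1)
        show "x \<in> Y \<longleftrightarrow> x \<in> B (Suc r) p n"
        proof
          assume "x \<in> Y"
          then obtain b z where xb: "x = b + D z" and b: "b \<in> B r p n" and z: "z \<in> Z r p'' (n - e)"
            by (auto simp: Y_def)
          then obtain y w where b: "b = y + D w" and y: "y \<in> Z (r - 1) (p + e) n"
            and w: "w \<in> Z (r - 1) (p - e * (int r - 1)) (n - e)"
            by (auto simp: B_iff)
          have "w \<in> F p'' (n - e)"
            using w by (intro F_mono[of w "p - e * (int r - 1)" _ p'' 1])
              (auto simp: Z_iff p'' algebra_simps)
          then have "w \<in> Z r p'' (n - e)"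
            using w r by (simp add: Z_iff p'' of_nat_diff)
          then have "z + w \<in> Z r p'' (n - e)" using z by (simp add: Z_add)
          moreover have "y \<in> Z r (p + e) n"
          proof -
            \<comment> \<open>The remainder \<open>y\<close> inherits the higher order of
              \<open>x\<close>, since the two differ by a boundary \<open>D (z + w)\<close>.\<close>
            have "D y = D x" by (simp add: xb b D_add D_D)
            then show ?thesis using y x by (simp add: Z_iff algebra_simps)
          qed
          moreover have "x = y + D (z + w)" by (simp add: xb b D_add algebra_simps)
          ultimately show "x \<in> B (Suc r) p n"
            by (simp add: p'' B_Suc_I)
        next
          assume "x \<in> B (Suc r) p n"
          then obtain y z where xb: "x = y + D z" and y: "y \<in> Z r (p + e) n" and z: "z \<in> Z r p'' (n - e)"
            by (auto simp: B_iff p'')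
          have "y \<in> B r p n" using y Z_mono[of y "r - 1" "p + e" n] r by (intro B_I1) simp
          then show "x \<in> Y" using z by (auto simp: Y_def xb)
        qed
      next
        fix x assume "x \<in> X"
        then have x: "x \<in> Z r p n" and "D x \<in> B r p' (n + e)" by (auto simp: X_def)
        then obtain y z where Dx: "D x = y + D z" and y: "y \<in> Z (r - 1) (p' + e) (n + e)"
          and z: "z \<in> Z (r - 1) (p' - e * (int r - 1)) n"
          by (auto simp: B_iff)
        have z': "z \<in> Z (r - 1) (p + e) n" using z by (simp add: p' algebra_simps)
        \<comment> \<open>Subtracting \<open>z\<close> removes the part \<open>D z\<close> of
          \<open>D x\<close> and leaves \<open>y\<close>, which lies one step deeper. The class of
          \<open>x\<close> modulo \<open>Y\<close> is unchanged because \<open>z\<close> itself is a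
          boundary of the page \<open>r\<close>.\<close>
        have "x - z \<in> Z (Suc r) p n"
        proof -
          have "x - z \<in> F p n"
            using x z' F_decreasing[of p n] by (intro F_diff) (auto simp: Z_iff)
          moreover have "D (x - z) = y" by (simp add: D_diff Dx)
          moreover have "y \<in> F (p + e * int (Suc r)) (n + e)"
            using y by (simp add: Z_iff p' algebra_simps)
          ultimately show ?thesis by (simp add: Z_iff)
        qed
        moreover have "x - (x - z) \<in> Y" using BY B_I1[OF z'] by auto
        ultimately show "\<exists>w\<in>Z (Suc r) p n. x - w \<in> Y" by blast
      qed (auto simp: diff_closed_Z diff_closed_B B_subset_Z X Y YX[THEN subsetD])
    qed
    finally show "(E r p s)\<lparr>carrier := kernel (E r p s) (E r p' s') (d r p s)\<rparr>
         Mod (d r p'' s'' ` carrier (E r p'' s''))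
        \<cong> E (Suc r) p s"
      unfolding ker im .
  qed
  show ?thesis
    unfolding spectral_sequence_def Let_def by (intro allI impI) (rule step[OF _ refl refl refl refl])
qed

text \<open>For large \<open>r\<close> the filtration has run out on both sides: the elements of
  \<open>Z r p n\<close> are honest cycles in \<open>F p n\<close>, and boundaries may come from the
  whole of \<open>C\<close>. The term is then the graded piece of the filtration of the homology by
  the images of the cycles of the steps.\<close>

lemma converges_to_homology:
  assumes low: "\<And>p. \<exists>r0. \<forall>r\<ge>r0. \<forall>n. F (p + e * int r) n = {0}"
    and high: "\<And>p. \<exists>r0. \<forall>r\<ge>r0. \<forall>n. F (p - e * int r) n = C n"
  shows "converges_to e E d (homology_of_complex e C D)"
proof -
  define Zc where "Zc n = {x \<in> C n. D x = 0}" for n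
  define Bc where "Bc n = D ` C (n - e)" for n
  define Fc where "Fc p n = {x \<in> F p n. D x = 0}" for p n
  \<comment> \<open>The cycles homologous to a cycle in \<open>F p n\<close>: the preimage of the
    step \<open>\<Phi> p n\<close> in the group of cycles.\<close>
  define X where "X p n = {b + x | b x. b \<in> Bc n \<and> x \<in> Fc p n}" for p n
  define \<Phi> where "\<Phi> p n = coset (Bc n) ` X p n" for p n
  have C_eq: "\<exists>p. \<forall>n. C n = F p n"
    using high[of 0] by (metis order_refl)
  then have C: "diff_closed (C n)" for n
    using diff_closed_F by metis
  have FC: "F p n \<subseteq> C n" for p n
  proof -
    obtain r where "F (p - e * int r) n = C n" using high by blast
    then show ?thesis using F_decreasing_mult[of "p - e * int r" r n] by simp
  qed
  have Zc: "diff_closed (Zc n)" for n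
    using C by (auto simp: Zc_def diff_closed_def D_diff D_zero)
  have Bc: "diff_closed (Bc n)" for n
    unfolding Bc_def by (intro diff_closed_image C additive_D)
  have Fc: "diff_closed (Fc p n)" for p n
    using diff_closed_F by (auto simp: Fc_def diff_closed_def D_diff D_zero)
  have X: "diff_closed (X p n)" for p n
    unfolding X_def by (intro diff_closed_sum Bc Fc)
  have BcZc: "Bc n \<subseteq> Zc n" for n
  proof
    fix x assume "x \<in> Bc n"
    then obtain z where z: "z \<in> C (n - e)" "x = D z" by (auto simp: Bc_def)
    obtain p where "\<And>n. C n = F p n" using C_eq by blast
    then have "D z \<in> C n" using z D_F[of z p "n - e"] by simp
    then show "x \<in> Zc n" using z by (simp add: Zc_def D_D)
  qed
  have FcX: "Fc p n \<subseteq> X p n" and BcX: "Bc n \<subseteq> X p n" for p n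
    using diff_closed_zero[OF Bc] diff_closed_zero[OF Fc] unfolding X_def by force+
  have XZc: "X p n \<subseteq> Zc n" for p n
  proof
    fix x assume "x \<in> X p n"
    then obtain b y where x: "x = b + y" "b \<in> Bc n" "y \<in> Fc p n" by (auto simp: X_def)
    then have "y \<in> Zc n" using FC by (auto simp: Fc_def Zc_def)
    then show "x \<in> Zc n" using x BcZc by (auto intro: diff_closed_add[OF Zc])
  qed
  have XX: "X (p + e) n \<subseteq> X p n" for p n
    unfolding X_def Fc_def using F_decreasing by blast
  have H: "homology_of_complex e C D n = add_group (Zc n) Mod Bc n" for n
    by (simp add: homology_of_complex_def Zc_def Bc_def)
  have X_all: "X p n = Zc n" if "\<forall>n. F p n = C n" for p n
    using that FcX[of p n] XZc[of p n] by (auto simp: Fc_def Zc_def)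
  have X_none: "X p n = Bc n" if "\<forall>n. F p n = {0}" for p n
    using that by (auto simp: X_def Fc_def D_zero)
  have filt: "subgroup (\<Phi> p n) (homology_of_complex e C D n)" for p n
    unfolding H \<Phi>_def using BcX XZc by (intro Mod_Mod_iso(3)[of _ _ _ "Bc n"] Zc Bc X) auto
  have graded: "add_group (X p n) Mod X (p + e) n
      \<cong> (homology_of_complex e C D n)\<lparr>carrier := \<Phi> p n\<rparr> Mod \<Phi> (p + e) n" for p n
    unfolding H \<Phi>_def by (intro Mod_Mod_iso(2) Zc Bc X BcX XX XZc)
  have stable: "(\<forall>x\<in>carrier (E r p s). d r p s x = \<one>\<^bsub>E r p' s'\<^esub>) \<and>
        (\<forall>x\<in>carrier (E r p'' s''). d r p'' s'' x = \<one>\<^bsub>E r p s\<^esub>) \<and>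
        E r p s \<cong> (homology_of_complex e C D n)\<lparr>carrier := \<Phi> p n\<rparr> Mod \<Phi> (p + e) n"
    if r: "r \<ge> 1" and low: "\<forall>n. F (p + e * int r) n = {0}"
      and high: "\<forall>n. F (p - e * (int r - 1)) n = C n" "\<forall>n. F (p - e * int r) n = C n"
      and n: "n = p + s"
      and p': "p' = p + e * int r" and s': "s' = s - e * (int r - 1)"
      and p'': "p'' = p - e * int r" and s'': "s'' = s + e * (int r - 1)" for r p s p' s' p'' s'' n
  proof (intro conjI ballI)
    have deg: "p' + s' = n + e" "p'' + s'' = n - e"
      by (simp_all add: n p' s' p'' s'' algebra_simps)
    have d1: "d r p s (coset (B r p n) x) = coset (B r p' (n + e)) (D x)" for x
      using diff_coset[OF r, of p s x] by (simp add: n p')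
    have d2: "d r p'' s'' (coset (B r p'' (n - e)) x) = coset (B r p n) (D x)" for x
      using diff_coset[OF r, of p'' s'' x] unfolding deg by (simp add: p'')
    have E: "E r p s = add_group (Z r p n) Mod B r p n"
        "E r p' s' = add_group (Z r p' (n + e)) Mod B r p' (n + e)"
        "E r p'' s'' = add_group (Z r p'' (n - e)) Mod B r p'' (n - e)"
      unfolding page_eq deg n by simp_all
    note car = carrier_add_group_Mod
    have Z: "Z r p n = Fc p n"
      using low by (auto simp: Z_iff Fc_def)
    have low': "F (p + e + e * (int r - 1)) m = {0}" for m
      using low by (simp add: algebra_simps)
    have Z1: "Z (r - 1) (p + e) n = Fc (p + e) n"
      using low' r by (auto simp: Z_iff Fc_def of_nat_diff)
    \<comment> \<open>All that remains of the condition on \<open>z\<close> is that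
      \<open>D z\<close> lies in \<open>F p n\<close>; the shifts by \<open>e * (r - 1)\<close>
      cancel.\<close>
    have Z2: "Z (r - 1) (p - e * (int r - 1)) (n - e) = {z \<in> C (n - e). D z \<in> F p n}"
      using high r by (auto simp: Z_iff of_nat_diff)
    have B: "x \<in> B r p n \<longleftrightarrow> (\<exists>y z. x = y + D z \<and> y \<in> Fc (p + e) n \<and> z \<in> C (n - e) \<and> D z \<in> F p n)" for x
      unfolding B_iff Z1 Z2 by blast
    show "d r p s x = \<one>\<^bsub>E r p' s'\<^esub>" if "x \<in> carrier (E r p s)" for x
      using that unfolding E car Z by (auto simp: d1 Fc_def coset_zero)
    show "d r p'' s'' x = \<one>\<^bsub>E r p s\<^esub>" if x: "x \<in> carrier (E r p'' s'')" for x
    proof -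
      obtain z where z: "z \<in> Z r p'' (n - e)" and xz: "x = coset (B r p'' (n - e)) z"
        using x unfolding E car by blast
      have "z \<in> C (n - e)" "D z \<in> F p n" using z FC by (auto simp: Z_iff p'')
      then have "D z \<in> B r p n" unfolding B using diff_closed_zero[OF Fc] by force
      then show ?thesis
        unfolding xz d2 E one_FactGroup by (simp add: coset_eq_self_iff diff_closed_B)
    qed
    have "E r p s \<cong> add_group (X p n) Mod X (p + e) n"
      unfolding E
    proof (rule add_group_Mod_iso[where f = "\<lambda>x. x"])
      fix x assume x: "x \<in> Z r p n"
      show "x \<in> X p n" using x FcX Z by blast
      show "x \<in> X (p + e) n \<longleftrightarrow> x \<in> B r p n"
      proof
        assume "x \<in> X (p + e) n"
        then obtain z y where xz: "x = D z + y" and z: "z \<in> C (n - e)" and y: "y \<in> Fc (p + e) n"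
          by (auto simp: X_def Bc_def)
        have "x \<in> F p n" "y \<in> F p n"
          using x y F_decreasing by (auto simp: Z Fc_def)
        then have "D z \<in> F p n" using F_diff[of x p n y] by (simp add: xz)
        then show "x \<in> B r p n" unfolding B using z y by (auto simp: xz add.commute)
      next
        assume "x \<in> B r p n"
        then obtain y z where "x = D z + y" "z \<in> C (n - e)" "y \<in> Fc (p + e) n"
          unfolding B by (auto simp: add.commute)
        then show "x \<in> X (p + e) n" unfolding X_def Bc_def by blast
      qed
    next
      fix x assume "x \<in> X p n"
      then obtain b y where x: "x = b + y" "b \<in> Bc n" "y \<in> Fc p n" by (auto simp: X_def)
      then show "\<exists>w\<in>Z r p n. x - w \<in> X (p + e) n"
        unfolding Z using BcX by (intro bexI[of _ y]) auto
    qed (auto simp: diff_closed_Z diff_closed_B X XX[THEN subsetD] dest: B_subset_Z[OF r, THEN subsetD])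
    also have "add_group (X p n) Mod X (p + e) n
        \<cong> (homology_of_complex e C D n)\<lparr>carrier := \<Phi> p n\<rparr> Mod \<Phi> (p + e) n"
      by (rule graded)
    finally show "E r p s \<cong> (homology_of_complex e C D n)\<lparr>carrier := \<Phi> p n\<rparr> Mod \<Phi> (p + e) n" .
  qed
  show ?thesis
    unfolding converges_to_def Let_def
  proof (rule exI[of _ \<Phi>], intro conjI allI)
    fix n p
    show "subgroup (\<Phi> p n) (homology_of_complex e C D n)" by (rule filt)
    show "\<Phi> (p + e) n \<subseteq> \<Phi> p n" unfolding \<Phi>_def using XX by blast
    obtain r where "\<forall>n. F (0 + e * int r) n = {0}" using low by blast
    from X_none[OF this] have "\<Phi> (0 + e * int r) n = {\<one>\<^bsub>homology_of_complex e C D n\<^esub>}"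
      unfolding \<Phi>_def H by (simp add: coset_image_self Bc)
    then show "\<exists>p. \<Phi> p n = {\<one>\<^bsub>homology_of_complex e C D n\<^esub>}" by blast
    obtain r where "\<forall>n. F (0 - e * int r) n = C n" using high by blast
    from X_all[OF this] have "\<Phi> (0 - e * int r) n = carrier (homology_of_complex e C D n)"
      unfolding \<Phi>_def H carrier_add_group_Mod by simp
    then show "\<exists>p. \<Phi> p n = carrier (homology_of_complex e C D n)" by blast
  next
    fix p s
    obtain r1 where r1: "\<forall>r\<ge>r1. \<forall>n. F (p + e * int r) n = {0}" using low by blast
    obtain r2 where r2: "\<forall>r\<ge>r2. \<forall>n. F (p - e * int r) n = C n" using high by blast
    \<comment> \<open>The successors make \<open>r \<ge> 1\<close> and let the second bound apply to
      \<open>r - 1\<close> as well, which is the shift occurring in the boundaries.\<close>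
    let ?r0 = "max (Suc r1) (Suc r2)"
    have "F (p - e * (int r - 1)) n = C n" if "r \<ge> ?r0" for r n
      using r2[rule_format, of "r - 1" n] that by (simp add: of_nat_diff)
    then have r0: "r \<ge> 1" "\<forall>n. F (p + e * int r) n = {0}"
      "\<forall>n. F (p - e * (int r - 1)) n = C n" "\<forall>n. F (p - e * int r) n = C n" if "r \<ge> ?r0" for r
      using that r1 r2 by auto
    show "\<exists>r0\<ge>1. \<forall>r\<ge>r0.
       (\<forall>x\<in>carrier (E r p s). d r p s x = \<one>\<^bsub>E r (p + e * int r) (s - e * (int r - 1))\<^esub>) \<and>
       (\<forall>x\<in>carrier (E r (p - e * int r) (s + e * (int r - 1))).
          d r (p - e * int r) (s + e * (int r - 1)) x = \<one>\<^bsub>E r p s\<^esub>) \<and>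
       E r p s \<cong> (homology_of_complex e C D (p + s))\<lparr>carrier := \<Phi> p (p + s)\<rparr> Mod \<Phi> (p + e) (p + s)"
    proof (rule exI[of _ ?r0], rule conjI)
      show "\<forall>r\<ge>?r0.
       (\<forall>x\<in>carrier (E r p s). d r p s x = \<one>\<^bsub>E r (p + e * int r) (s - e * (int r - 1))\<^esub>) \<and>
       (\<forall>x\<in>carrier (E r (p - e * int r) (s + e * (int r - 1))).
          d r (p - e * int r) (s + e * (int r - 1)) x = \<one>\<^bsub>E r p s\<^esub>) \<and>
       E r p s \<cong> (homology_of_complex e C D (p + s))\<lparr>carrier := \<Phi> p (p + s)\<rparr> Mod \<Phi> (p + e) (p + s)"
        by (intro allI impI, rule stable[OF r0 refl refl refl refl refl])
    qed simp
  qed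
qed

end

section \<open>Direct sums\<close>

text \<open>Turns one term of the page into a direct sum, so that the claim for a single
  \<open>p\<close> and the claim for all \<open>p\<close> both follow from
  \<open>sum_group_iso_reindex\<close>.\<close>

lemma sum_group_singleton:
  assumes "group (H t)"
  shows "H t \<cong> sum_group {t} H"
proof -
  interpret group "H t" by fact
  have car: "carrier (sum_group {t} H) = (\<Pi>\<^sub>E i\<in>{t}. carrier (H i))"
    using assms by (subst carrier_sum_group) auto
  have "(\<lambda>x. \<lambda>i\<in>{t}. x) \<in> iso (H t) (sum_group {t} H)"
  proof (rule isoI)
    show "(\<lambda>x. \<lambda>i\<in>{t}. x) \<in> hom (H t) (sum_group {t} H)"
      by (rule homI) (auto simp: car fun_eq_iff)
    show "bij_betw (\<lambda>x. \<lambda>i\<in>{t}. x) (carrier (H t)) (carrier (sum_group {t} H))"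
      by (rule bij_betwI[where g = "\<lambda>x. x t"])
        (auto simp: car fun_eq_iff PiE_iff extensional_def)
  qed
  then show ?thesis by (auto simp: is_iso_def)
qed

text \<open>Finite support survives because the coordinate \<open>j\<close> of the image can differ
  from the unit only if the coordinate \<open>\<rho> j\<close> of \<open>x\<close> does, and
  \<open>\<rho>\<close> is injective on \<open>J0\<close>. The isomorphism below and its inverse are
  both of this form.\<close>

lemma hom_sum_group_reindex:
  assumes G: "\<And>i. i \<in> I \<Longrightarrow> group (G i)" and H: "\<And>j. j \<in> J \<Longrightarrow> group (H j)"
    and sub: "I0 \<subseteq> I" "J0 \<subseteq> J" and \<rho>: "bij_betw \<rho> J0 I0"
    and f: "\<And>j. j \<in> J0 \<Longrightarrow> f j \<in> hom (G (\<rho> j)) (H j)"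
  shows "(\<lambda>x. \<lambda>j\<in>J. if j \<in> J0 then f j (x (\<rho> j)) else \<one>\<^bsub>H j\<^esub>) \<in> hom (sum_group I G) (sum_group J H)"
    (is "?h \<in> _")
proof (rule homI)
  have one: "f j \<one>\<^bsub>G (\<rho> j)\<^esub> = \<one>\<^bsub>H j\<^esub>" if "j \<in> J0" for j
    using hom_one[OF f[OF that]] that sub \<rho> G H by (auto simp: bij_betw_def)
  fix x assume x: "x \<in> carrier (sum_group I G)"
  have xin: "x (\<rho> j) \<in> carrier (G (\<rho> j))" if "j \<in> J0" for j
    using x that sub \<rho> by (auto simp: carrier_sum_group G bij_betw_def PiE_iff)
  have "{j \<in> J. ?h x j \<noteq> \<one>\<^bsub>H j\<^esub>} \<subseteq> {j \<in> J0. \<rho> j \<in> {i \<in> I. x i \<noteq> \<one>\<^bsub>G i\<^esub>}}"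
    using one sub \<rho> by (auto simp: bij_betw_def split: if_splits)
  moreover have "finite {j \<in> J0. \<rho> j \<in> {i \<in> I. x i \<noteq> \<one>\<^bsub>G i\<^esub>}}"
    using x \<rho> by (intro finite_inverse_image_gen) (auto simp: carrier_sum_group G bij_betw_def)
  ultimately have "finite {j \<in> J. ?h x j \<noteq> \<one>\<^bsub>H j\<^esub>}" by (rule finite_subset)
  then show "?h x \<in> carrier (sum_group J H)"
    using hom_in_carrier[OF f xin] H sub by (auto simp: carrier_sum_group H group.is_monoid)
  fix y assume y: "y \<in> carrier (sum_group I G)"
  have yin: "y (\<rho> j) \<in> carrier (G (\<rho> j))" if "j \<in> J0" for j
    using y that sub \<rho> by (auto simp: carrier_sum_group G bij_betw_def PiE_iff)
  have "\<rho> j \<in> I" if "j \<in> J0" for j using that sub \<rho> by (auto simp: bij_betw_def)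
  then show "?h (x \<otimes>\<^bsub>sum_group I G\<^esub> y) = ?h x \<otimes>\<^bsub>sum_group J H\<^esub> ?h y"
    using hom_mult[OF f xin yin] monoid.l_one[OF group.is_monoid[OF H] monoid.one_closed[OF group.is_monoid[OF H]]]
    by (simp add: fun_eq_iff)
qed

text \<open>Only the summands over \<open>I0\<close> and \<open>J0\<close> are matched; the others
  are trivial. This compares a sum over all integers \<open>p\<close> with a sum over finitely many
  tiles.\<close>

lemma sum_group_iso_reindex:
  assumes G: "\<And>i. i \<in> I \<Longrightarrow> group (G i)" and H: "\<And>j. j \<in> J \<Longrightarrow> group (H j)"
    and sub: "I0 \<subseteq> I" "J0 \<subseteq> J" and \<pi>: "bij_betw \<pi> I0 J0"
    and iso: "\<And>i. i \<in> I0 \<Longrightarrow> G i \<cong> H (\<pi> i)"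
    and trivG: "\<And>i. i \<in> I - I0 \<Longrightarrow> trivial_group (G i)"
    and trivH: "\<And>j. j \<in> J - J0 \<Longrightarrow> trivial_group (H j)"
  shows "sum_group I G \<cong> sum_group J H"
proof -
  define \<rho> where "\<rho> = inv_into I0 \<pi>"
  have \<rho>: "bij_betw \<rho> J0 I0" unfolding \<rho>_def using \<pi> by (rule bij_betw_inv_into)
  have \<rho>\<pi>: "\<rho> (\<pi> i) = i" if "i \<in> I0" for i
    using that \<pi> by (simp add: \<rho>_def bij_betw_inv_into_left)
  have \<pi>\<rho>: "\<pi> (\<rho> j) = j" if "j \<in> J0" for j
    using that \<pi> by (simp add: \<rho>_def bij_betw_inv_into_right)
  have \<pi>J: "\<pi> i \<in> J0" if "i \<in> I0" for i using that \<pi> by (auto simp: bij_betw_def)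
  have \<rho>I: "\<rho> j \<in> I0" if "j \<in> J0" for j using that \<rho> by (auto simp: bij_betw_def)
  have "\<forall>i\<in>I0. \<exists>f. f \<in> iso (G i) (H (\<pi> i))"
    using iso by (auto simp: is_iso_def)
  then obtain f where f: "\<And>i. i \<in> I0 \<Longrightarrow> f i \<in> iso (G i) (H (\<pi> i))"
    by metis
  define g where "g i = inv_into (carrier (G i)) (f i)" for i
  have g: "g i \<in> iso (H (\<pi> i)) (G i)" if "i \<in> I0" for i
    unfolding g_def using group.iso_set_sym[OF G f[OF that]] that sub by auto
  let ?h = "\<lambda>x. \<lambda>j\<in>J. if j \<in> J0 then f (\<rho> j) (x (\<rho> j)) else \<one>\<^bsub>H j\<^esub>"
  let ?k = "\<lambda>y. \<lambda>i\<in>I. if i \<in> I0 then g i (y (\<pi> i)) else \<one>\<^bsub>G i\<^esub>"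
  have hh: "?h \<in> hom (sum_group I G) (sum_group J H)"
    using f[OF \<rho>I] \<pi>\<rho> by (intro hom_sum_group_reindex[where ?I0.0 = I0 and ?J0.0 = J0] G H sub \<rho>) (auto simp: iso_def)
  have kk: "?k \<in> hom (sum_group J H) (sum_group I G)"
    using g by (intro hom_sum_group_reindex[where ?I0.0 = J0 and ?J0.0 = I0] G H sub \<pi>) (auto simp: iso_def)
  have "bij_betw ?h (carrier (sum_group I G)) (carrier (sum_group J H))"
  proof (rule bij_betwI[where g = ?k])
    show "?h \<in> carrier (sum_group I G) \<rightarrow> carrier (sum_group J H)"
      using hh by (auto simp: hom_def)
    show "?k \<in> carrier (sum_group J H) \<rightarrow> carrier (sum_group I G)"
      using kk by (auto simp: hom_def)
    fix x assume "x \<in> carrier (sum_group I G)"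
    then have x: "x \<in> extensional I" "\<And>i. i \<in> I \<Longrightarrow> x i \<in> carrier (G i)"
      by (auto simp: carrier_sum_group G PiE_iff)
    show "?k (?h x) = x"
    proof
      fix i
      show "?k (?h x) i = x i"
      proof (cases "i \<in> I0")
        case True
        then have i: "i \<in> I" "\<pi> i \<in> J" "\<pi> i \<in> J0" using sub \<pi>J by auto
        have "inj_on (f i) (carrier (G i))" using f[OF True] by (auto simp: iso_def bij_betw_def)
        then show ?thesis using True i x by (simp add: \<rho>\<pi> g_def)
      next
        case False
        then show ?thesis
          using x(1) x(2)[of i] trivG[of i] by (auto simp: trivial_group_def extensional_def)
      qed
    qed
  next
    fix y assume "y \<in> carrier (sum_group J H)"
    then have y: "y \<in> extensional J" "\<And>j. j \<in> J \<Longrightarrow> y j \<in> carrier (H j)"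
      by (auto simp: carrier_sum_group H PiE_iff)
    show "?h (?k y) = y"
    proof
      fix j
      show "?h (?k y) j = y j"
      proof (cases "j \<in> J0")
        case True
        then have j: "j \<in> J" "\<rho> j \<in> I" "\<rho> j \<in> I0" using sub \<rho>I by auto
        have "f (\<rho> j) ` carrier (G (\<rho> j)) = carrier (H j)"
          using f[OF j(3)] \<pi>\<rho>[OF True] by (auto simp: iso_def bij_betw_def)
        then have "f (\<rho> j) (g (\<rho> j) (y j)) = y j"
          unfolding g_def using y(2)[OF j(1)] by (intro f_inv_into_f) simp
        then show ?thesis using True j by (simp add: \<pi>\<rho>)
      next
        case False
        then show ?thesis
          using y(1) y(2)[of j] trivH[of j] by (auto simp: trivial_group_def extensional_def)
      qed
    qed
  qed
  then have "?h \<in> iso (sum_group I G) (sum_group J H)"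
    using hh by (simp add: isoI)
  then show ?thesis by (auto simp: is_iso_def)
qed

section \<open>Complexes spanned by oriented simplices\<close>

lemma signed_0 [simp]: "signed i 0 = 0"
  and signed_signed: "signed i (signed j x) = signed (i + j) x"
  and signed_signed_same [simp]: "signed i (signed i x) = x"
  and signed_add: "signed i (x + y) = signed i x + signed i y"
  and signed_Suc: "signed (Suc i) x = - signed i x"
  and signed_eq_0_iff [simp]: "signed i x = 0 \<longleftrightarrow> x = 0"
  by (auto simp: signed_def)

lemma signed_sum: "signed i (\<Sum>x\<in>A. f x) = (\<Sum>x\<in>A. signed i (f x))"
  by (simp add: signed_def sum_negf)

text \<open>The boundary and the coboundary are both of this form: \<open>R x y\<close> says that \<open>y\<close> contributes to
  the coefficient of \<open>x\<close> in the differential, with the sign given by \<open>i x y\<close>.\<close>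

definition incidence_diff ::
  "('b \<Rightarrow> 'b \<Rightarrow> bool) \<Rightarrow> ('b \<Rightarrow> 'b \<Rightarrow> nat) \<Rightarrow> 'b set \<Rightarrow> ('b \<Rightarrow> 'g::ab_group_add) \<Rightarrow> 'b \<Rightarrow> 'g" where
  "incidence_diff R i A c x = (if x \<in> A then \<Sum>y | y \<in> A \<and> R x y. signed (i x y) (c y) else 0)"

lemma simplicial_boundary_eq:
  "simplicial_boundary \<nu> A =
     incidence_diff (\<lambda>\<tau> \<sigma>. \<tau> facet_of \<sigma>) (\<lambda>\<tau> \<sigma>. omitted_position \<nu> \<sigma> \<tau>) A"
  by (intro ext) (simp add: simplicial_boundary_def incidence_diff_def)

lemma simplicial_coboundary_eq:
  "simplicial_coboundary \<nu> A =
     incidence_diff (\<lambda>\<sigma> \<tau>. \<tau> facet_of \<sigma>) (\<lambda>\<sigma> \<tau>. omitted_position \<nu> \<sigma> \<tau>) A"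
  by (intro ext) (simp add: simplicial_coboundary_def incidence_diff_def)

lemma simplicial_chainsD:
  "c \<in> simplicial_chains A n \<Longrightarrow> c \<sigma> \<noteq> 0 \<Longrightarrow> \<sigma> \<in> A \<and> \<sigma> \<noteq> {} \<and> aff_dim \<sigma> = n"
  and simplicial_chainsI:
  "(\<And>\<sigma>. c \<sigma> \<noteq> 0 \<Longrightarrow> \<sigma> \<in> A \<and> \<sigma> \<noteq> {} \<and> aff_dim \<sigma> = n) \<Longrightarrow> c \<in> simplicial_chains A n"
  by (simp_all add: simplicial_chains_def)

lemma diff_closed_simplicial_chains: "diff_closed (simplicial_chains A n)"
  unfolding diff_closed_def
proof (intro conjI ballI)
  fix x y :: "'a set \<Rightarrow> 'b" assume xy: "x \<in> simplicial_chains A n" "y \<in> simplicial_chains A n"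
  have "x \<sigma> \<noteq> 0 \<or> y \<sigma> \<noteq> 0" if "(x - y) \<sigma> \<noteq> 0" for \<sigma> using that by auto
  then show "x - y \<in> simplicial_chains A n"
    using simplicial_chainsD[OF xy(1)] simplicial_chainsD[OF xy(2)] by (intro simplicial_chainsI) blast
qed (simp add: simplicial_chains_def)

text \<open>Families that differ only by the empty simplex have the same chains.\<close>

lemma simplicial_chains_cong:
  assumes "\<And>\<sigma>. \<sigma> \<noteq> {} \<Longrightarrow> \<sigma> \<in> A \<longleftrightarrow> \<sigma> \<in> A'"
  shows "simplicial_chains A n = simplicial_chains A' n"
  unfolding simplicial_chains_def using assms by (intro Collect_cong) metis

lemma simplicial_chains_trivial:
  assumes "\<And>\<sigma>. \<sigma> \<in> A \<Longrightarrow> \<sigma> \<noteq> {} \<Longrightarrow> aff_dim \<sigma> \<noteq> n"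
  shows "simplicial_chains A n = {0}"
proof (intro equalityI subsetI)
  fix c :: "'a set \<Rightarrow> 'b" assume c: "c \<in> simplicial_chains A n"
  have "c \<sigma> = 0" for \<sigma> using simplicial_chainsD[OF c, of \<sigma>] assms[of \<sigma>] by blast
  then show "c \<in> {0}" by (simp add: fun_eq_iff)
qed (simp add: simplicial_chains_def)

lemma simplicial_chains_mono: "A \<subseteq> A' \<Longrightarrow> simplicial_chains A n \<subseteq> simplicial_chains A' n"
  by (auto simp: simplicial_chains_def)

text \<open>Boundary and coboundary differ in the sign of \<open>e\<close> and in the direction of
  \<open>R\<close>. The axiom \<open>cancel\<close> is the matrix form of \<open>D_D\<close>: the
  signed paths of length two between two given simplices sum to zero.\<close>

locale incidence =
  fixes e :: int and R :: "'a::euclidean_space set \<Rightarrow> 'a set \<Rightarrow> bool" and i :: "'a set \<Rightarrow> 'a set \<Rightarrow> nat"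
    and A :: "'a set set" and D :: "('a set \<Rightarrow> 'g::ab_group_add) \<Rightarrow> 'a set \<Rightarrow> 'g"
  assumes D_eq: "D = incidence_diff R i A"
    and finite_A: "finite A"
    and degree: "x \<in> A \<Longrightarrow> y \<in> A \<Longrightarrow> R x y \<Longrightarrow> aff_dim x = aff_dim y + e"
    and nonempty: "R x y \<Longrightarrow> x \<noteq> {}" "R x y \<Longrightarrow> y \<noteq> {}"
    and cancel: "x \<in> A \<Longrightarrow> z \<in> A \<Longrightarrow>
      (\<Sum>y | y \<in> A \<and> R x y \<and> R y z. signed (i x y) (signed (i y z) (g::'g))) = 0"
begin

abbreviation H :: "int \<Rightarrow> ('a set \<Rightarrow> 'g) set monoid" where
  "H \<equiv> homology_of_complex e (simplicial_chains A) D"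

lemma D_apply: "D c x = (if x \<in> A then \<Sum>y | y \<in> A \<and> R x y. signed (i x y) (c y) else 0)"
  by (simp add: D_eq incidence_diff_def)

lemma additive_D: "Modules.additive D"
  by unfold_locales (auto simp: D_apply fun_eq_iff signed_add sum.distrib)

lemma D_D: "D (D c) = 0"
proof
  fix x
  show "D (D c) x = 0 x"
  proof (cases "x \<in> A")
    case True
    have "D (D c) x = (\<Sum>y | y \<in> A \<and> R x y. \<Sum>z | z \<in> A \<and> R y z. signed (i x y) (signed (i y z) (c z)))"
      using True by (simp add: D_apply signed_sum)
    also have "\<dots> = (\<Sum>z\<in>A. \<Sum>y | y \<in> A \<and> R x y \<and> R y z. signed (i x y) (signed (i y z) (c z)))"
    proof -
      have "(\<Sum>y | y \<in> A \<and> R x y. \<Sum>z | z \<in> A \<and> R y z. f y z) =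
          (\<Sum>z\<in>A. \<Sum>y | y \<in> {y \<in> A. R x y} \<and> R y z. f y z)" for f :: "'a set \<Rightarrow> 'a set \<Rightarrow> 'g"
        using finite_A by (intro sum.swap_restrict) auto
      then show ?thesis by (simp add: conj_assoc)
    qed
    also have "\<dots> = 0"
      by (simp add: cancel[OF True])
    finally show ?thesis by simp
  qed (simp add: D_apply)
qed

lemma D_simplicial_chains:
  assumes B: "B \<subseteq> A" "\<And>x y. x \<in> A \<Longrightarrow> R x y \<Longrightarrow> y \<in> B \<Longrightarrow> x \<in> B"
    and c: "c \<in> simplicial_chains B n"
  shows "D c \<in> simplicial_chains B (n + e)"
  unfolding simplicial_chains_def
proof (intro CollectI allI impI)
  fix x assume nz: "D c x \<noteq> 0"
  then have x: "x \<in> A" by (auto simp: D_apply split: if_splits)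
  have "(\<Sum>y | y \<in> A \<and> R x y. signed (i x y) (c y)) \<noteq> 0"
    using nz x by (simp add: D_apply)
  then obtain y where "y \<in> {y. y \<in> A \<and> R x y}" and nz: "signed (i x y) (c y) \<noteq> 0"
    by (rule sum.not_neutral_contains_not_neutral)
  then have y: "y \<in> A" "R x y" by auto
  have "y \<in> B" "aff_dim y = n" using c nz by (auto simp: simplicial_chains_def)
  then show "x \<in> B \<and> x \<noteq> {} \<and> aff_dim x = n + e"
    using B x y nonempty degree by auto
qed

lemma boundaries_subset_cycles:
  "D ` simplicial_chains A (n - e) \<subseteq> {c \<in> simplicial_chains A n. D c = 0}"
  using D_simplicial_chains[of A _ "n - e"] D_D by auto

lemma diff_closed_cycles: "diff_closed {c \<in> simplicial_chains A n. D c = 0}"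
  using diff_closed_simplicial_chains[of A n] additive.diff[OF additive_D] additive.zero[OF additive_D]
  by (auto simp: diff_closed_def)

lemma diff_closed_boundaries: "diff_closed (D ` simplicial_chains A n)"
  by (intro diff_closed_image diff_closed_simplicial_chains additive_D)

lemma comm_group_H: "comm_group (H n)"
  unfolding homology_of_complex_def
  by (intro comm_group_add_group_Mod diff_closed_cycles diff_closed_boundaries boundaries_subset_cycles)

lemma trivial_group_H_no_simplices:
  assumes "\<And>\<sigma>. \<sigma> \<in> A \<Longrightarrow> \<sigma> \<noteq> {} \<Longrightarrow> aff_dim \<sigma> \<noteq> n"
  shows "trivial_group (H n)"
proof -
  have "simplicial_chains A n = {0 :: 'a set \<Rightarrow> 'g}"
    using assms by (rule simplicial_chains_trivial)
  then have "{c \<in> simplicial_chains A n. D c = 0} = {0}"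
    using additive.zero[OF additive_D] by auto
  then have "carrier (H n) = {\<one>\<^bsub>H n\<^esub>}"
    unfolding homology_of_complex_def by (simp add: carrier_add_group_Mod coset_zero)
  then show ?thesis
    using comm_group_H[of n] by (simp add: trivial_group_def comm_group_def)
qed

text \<open>The component of the differential from \<open>A2\<close> to \<open>A1\<close> is an invertible diagonal matrix, so a cycle
  can be made to vanish on \<open>A1\<close> by subtracting a boundary, and then it vanishes on \<open>A2\<close> too.\<close>

lemma trivial_group_H:
  assumes A: "A = A1 \<union> A2" "A1 \<inter> A2 = {}" "{} \<notin> A" and m: "bij_betw m A1 A2"
    and R: "\<And>x y. x \<in> A1 \<Longrightarrow> y \<in> A2 \<Longrightarrow> R x y \<longleftrightarrow> y = m x"
  shows "trivial_group (H n)"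
proof -
  have mA: "m x \<in> A2" if "x \<in> A1" for x using that m by (auto simp: bij_betw_def)
  have diag: "D b x = signed (i x (m x)) (b (m x))" if x: "x \<in> A1" and b: "\<And>y. y \<in> A1 \<Longrightarrow> b y = 0" for b x
  proof -
    have "D b x = (\<Sum>y | y \<in> A \<and> R x y. signed (i x y) (b y))"
      using x A by (simp add: D_apply)
    also have "\<dots> = (\<Sum>y\<in>{m x}. signed (i x y) (b y))"
      using x mA R A b finite_A by (intro sum.mono_neutral_right) auto
    finally show ?thesis by simp
  qed
  have "c \<in> D ` simplicial_chains A (n - e)" if c: "c \<in> simplicial_chains A n" and Dc: "D c = 0" for c
  proof -
    define w where "w = inv_into A1 m"
    have w: "w (m x) = x" if "x \<in> A1" for x
      unfolding w_def using that m by (simp add: bij_betw_inv_into_left)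
    have w': "w y \<in> A1" "m (w y) = y" if "y \<in> A2" for y
      unfolding w_def using that m by (auto simp: bij_betw_def inv_into_into f_inv_into_f)
    \<comment> \<open>\<open>b\<close> is supported on \<open>A2\<close> and undoes the diagonal
      entries, each sign being its own inverse; hence \<open>D b\<close> agrees with
      \<open>c\<close> on \<open>A1\<close>.\<close>
    define b where "b y = (if y \<in> A2 then signed (i (w y) y) (c (w y)) else 0)" for y
    have b: "b \<in> simplicial_chains A (n - e)"
      unfolding simplicial_chains_def
    proof (intro CollectI allI impI)
      fix y assume "b y \<noteq> 0"
      then have y: "y \<in> A2" "c (w y) \<noteq> 0" by (auto simp: b_def split: if_splits)
      then have "aff_dim (w y) = n" using c by (auto simp: simplicial_chains_def)
      moreover have "R (w y) y" using R w' y by auto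
      ultimately show "y \<in> A \<and> y \<noteq> {} \<and> aff_dim y = n - e"
        using degree[of "w y" y] w'[OF y(1)] y A by auto
    qed
    define c' where "c' = c - D b"
    have "b y = 0" if "y \<in> A1" for y
      using that A(2) by (auto simp: b_def)
    then have "D b x = c x" if "x \<in> A1" for x
      using diag[OF that] that w mA by (simp add: b_def)
    then have 1: "c' x = 0" if "x \<in> A1" for x
      using that by (simp add: c'_def)
    have Dc': "D c' = 0" by (simp add: c'_def additive.diff[OF additive_D] Dc D_D)
    \<comment> \<open>As \<open>c'\<close> vanishes on \<open>A1\<close>, the equation
      \<open>D c' = 0\<close> at \<open>w y\<close> consists of the single term at
      \<open>y\<close>.\<close>
    have "c' y = 0" for y
    proof (cases "y \<in> A2")
      case True
      then have "signed (i (w y) y) (c' y) = 0"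
        using diag[of "w y" c'] w' 1 Dc' by simp
      then show ?thesis by simp
    next
      case False
      have "D b \<in> simplicial_chains A n" using b boundaries_subset_cycles by blast
      then have "y \<notin> A \<Longrightarrow> c y = 0 \<and> D b y = 0" using c unfolding simplicial_chains_def by blast
      then show ?thesis using False 1 A(1) by (cases "y \<in> A1") (auto simp: c'_def)
    qed
    then have "c = D b" by (auto simp: c'_def fun_eq_iff)
    then show ?thesis using b by blast
  qed
  then have "{c \<in> simplicial_chains A n. D c = 0} = D ` simplicial_chains A (n - e)"
    using boundaries_subset_cycles[of n] by blast
  then have "carrier (H n) = {\<one>\<^bsub>H n\<^esub>}"
    unfolding homology_of_complex_def
    by (simp add: carrier_add_group_Mod coset_image_self diff_closed_boundaries)
  then show ?thesis
    using comm_group_H[of n] by (simp add: trivial_group_def comm_group_def)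
qed

end

text \<open>\<open>Bs_closed\<close> says that the differential of a simplex in \<open>Bs p\<close>
  stays in \<open>Bs p\<close>. For the boundary this means closed under facets, for the coboundary
  the complement of such a family.\<close>

locale filtered_incidence = incidence e R i A D
  for e :: int and R :: "'a::euclidean_space set \<Rightarrow> 'a set \<Rightarrow> bool" and i :: "'a set \<Rightarrow> 'a set \<Rightarrow> nat"
    and A :: "'a set set" and D :: "('a set \<Rightarrow> 'g::ab_group_add) \<Rightarrow> 'a set \<Rightarrow> 'g" +
  fixes Bs :: "int \<Rightarrow> 'a set set"
  assumes Bs_A: "Bs p \<subseteq> A" and Bs_decreasing: "Bs (p + e) \<subseteq> Bs p"
    and Bs_closed: "x \<in> A \<Longrightarrow> R x y \<Longrightarrow> y \<in> Bs p \<Longrightarrow> x \<in> Bs p"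

sublocale filtered_incidence \<subseteq> filtered_complex e "\<lambda>p. simplicial_chains (Bs p)" D
proof
  show "simplicial_chains (Bs (p + e)) n \<subseteq> simplicial_chains (Bs p) n" for p n
    using Bs_decreasing by (rule simplicial_chains_mono)
  show "D x \<in> simplicial_chains (Bs p) (n + e)" if "x \<in> simplicial_chains (Bs p) n" for x p n
    by (rule D_simplicial_chains[OF Bs_A Bs_closed that])
qed (simp_all add: diff_closed_simplicial_chains additive.add[OF additive_D] D_D)

context filtered_incidence
begin

text \<open>The page 1 is the homology of \<open>F p\<close> modulo \<open>F (p + e)\<close>, and
  restriction of chains to \<open>AT\<close> realises this quotient. \<open>AT\<close> is controlled
  in dimensions up to \<open>q\<close> only, and may have larger simplices outside \<open>A\<close>;
  \<open>n < int q\<close> and \<open>\<bar>e\<bar> \<le> 1\<close> keep the degrees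
  \<open>n - e\<close>, \<open>n\<close> and \<open>n + e\<close> within the controlled
  range.\<close>

lemma first_page_iso:
  fixes DT :: "('a set \<Rightarrow> 'g) \<Rightarrow> 'a set \<Rightarrow> 'g"
  assumes T: "incidence e R i AT DT" and e: "\<bar>e\<bar> \<le> 1" and n: "n < int q"
    and AT: "\<And>\<sigma>. \<sigma> \<noteq> {} \<Longrightarrow> aff_dim \<sigma> \<le> int q \<Longrightarrow> \<sigma> \<in> AT \<longleftrightarrow> \<sigma> \<in> Bs p - Bs (p + e)"
  shows "E 1 p (n - p) \<cong> homology_of_complex e (simplicial_chains AT) DT n"
proof -
  interpret T: incidence e R i AT DT by (rule T)
  define f where "f c \<sigma> = (if \<sigma> \<in> AT then c \<sigma> else 0)" for c :: "'a set \<Rightarrow> 'g" and \<sigma>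
  let ?C = "simplicial_chains AT :: int \<Rightarrow> ('a set \<Rightarrow> 'g) set" and ?F = "\<lambda>p n. simplicial_chains (Bs p) n :: ('a set \<Rightarrow> 'g) set"
  have f_C: "f c \<in> ?C m" if "c \<in> ?F p m" for c m
    using simplicial_chainsD[OF that] by (intro simplicial_chainsI) (auto simp: f_def split: if_splits)
  have C_F: "c \<in> ?F p m" if "c \<in> ?C m" "m \<le> int q" for c m
    using simplicial_chainsD[OF that(1)] AT that(2) by (intro simplicial_chainsI) blast
  have f_id: "f c = c" if "c \<in> ?C m" for c m
    using simplicial_chainsD[OF that] unfolding f_def by (intro ext) (metis (no_types))
  have f_eq_0: "f c = 0 \<longleftrightarrow> c \<in> ?F (p + e) m" if c: "c \<in> ?F p m" and m: "m \<le> int q" for c m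
  proof
    assume fc: "f c = 0"
    show "c \<in> ?F (p + e) m"
    proof (rule simplicial_chainsI)
      fix \<sigma> assume nz: "c \<sigma> \<noteq> 0"
      then have "\<sigma> \<notin> AT" using fun_cong[OF fc, of \<sigma>] by (auto simp: f_def)
      then show "\<sigma> \<in> Bs (p + e) \<and> \<sigma> \<noteq> {} \<and> aff_dim \<sigma> = m"
        using simplicial_chainsD[OF c nz] AT[of \<sigma>] m by blast
    qed
  next
    assume c': "c \<in> ?F (p + e) m"
    show "f c = 0"
    proof
      fix \<sigma> show "f c \<sigma> = 0 \<sigma>"
        using simplicial_chainsD[OF c', of \<sigma>] AT[of \<sigma>] m by (auto simp: f_def)
    qed
  qed
  have f_D: "f (D c) = DT (f c)" if c: "c \<in> ?F p m" and m: "m \<le> int q" "m + e \<le> int q" for c m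
  proof
    fix \<sigma>
    have Dc: "D c \<in> ?F p (m + e)" using D_F[OF c] .
    have DTc: "DT (f c) \<in> ?C (m + e)"
      using T.D_simplicial_chains[of AT "f c" m] f_C[OF c] by auto
    show "f (D c) \<sigma> = DT (f c) \<sigma>"
    proof (cases "\<sigma> \<in> AT \<and> \<sigma> \<noteq> {} \<and> aff_dim \<sigma> = m + e")
      case True
      then have \<sigma>: "\<sigma> \<in> Bs p" "\<sigma> \<notin> Bs (p + e)" "\<sigma> \<in> A"
        using AT[of \<sigma>] m Bs_A[of p] by auto
      have AT_iff: "y \<in> AT \<longleftrightarrow> y \<in> Bs p - Bs (p + e)" if "c y \<noteq> 0" for y
        using simplicial_chainsD[OF c that] AT[of y] m by simp
      \<comment> \<open>A simplex \<open>y\<close> in the support of \<open>c\<close> but outside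
        \<open>AT\<close> lies in the smaller step \<open>Bs (p + e)\<close>, which is stable under
        the differential; so it cannot contribute to \<open>\<sigma>\<close>, which is not in that
        step.\<close>
      have "(\<Sum>y | y \<in> A \<and> R \<sigma> y. signed (i \<sigma> y) (c y)) = (\<Sum>y | y \<in> AT \<and> R \<sigma> y. signed (i \<sigma> y) (f c y))"
      proof (rule sum.mono_neutral_cong)
        fix y assume y: "y \<in> {y. y \<in> A \<and> R \<sigma> y} - {y. y \<in> AT \<and> R \<sigma> y}"
        show "signed (i \<sigma> y) (c y) = 0"
        proof (rule ccontr)
          assume "\<not> ?thesis"
          then have "c y \<noteq> 0" by auto
          then have "y \<in> Bs (p + e)" using AT_iff[of y] simplicial_chainsD[OF c, of y] y by blast
          then show False using Bs_closed[of \<sigma> y "p + e"] \<sigma> y by blast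
        qed
      next
        fix y assume y: "y \<in> {y. y \<in> AT \<and> R \<sigma> y} - {y. y \<in> A \<and> R \<sigma> y}"
        show "signed (i \<sigma> y) (f c y) = 0"
        proof (rule ccontr)
          assume "\<not> ?thesis"
          then have "c y \<noteq> 0" by (auto simp: f_def split: if_splits)
          then show False using AT_iff[of y] y Bs_A[of p] by blast
        qed
      qed (auto simp: finite_A T.finite_A f_def)
      then show ?thesis using True \<sigma> by (simp add: f_def D_apply T.D_apply)
    next
      case False
      then have "f (D c) \<sigma> = 0" "DT (f c) \<sigma> = 0"
        using simplicial_chainsD[OF Dc, of \<sigma>] simplicial_chainsD[OF DTc, of \<sigma>]
        unfolding f_def by (metis (full_types))+
      then show ?thesis by simp
    qed
  qed
  have f_add: "f (x + y) = f x + f y" for x y by (auto simp: f_def fun_eq_iff)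
  have f_diff: "f (x - y) = f x - f y" for x y by (auto simp: f_def fun_eq_iff)
  have m: "n \<le> int q" "n + e \<le> int q" "n - e \<le> int q" using n e by auto
  have Z0: "Z 0 p m = ?F p m" for p m
    by (auto simp: filtered_cycles_def intro: D_F)
  have Z1: "c \<in> Z 1 p n \<longleftrightarrow> c \<in> ?F p n \<and> DT (f c) = 0" for c
  proof -
    have "DT (f c) = 0 \<longleftrightarrow> D c \<in> ?F (p + e) (n + e)" if c: "c \<in> ?F p n"
      using f_eq_0[OF D_F[OF c] m(2)] f_D[OF c m(1,2)] by simp
    then show ?thesis unfolding Z_iff by auto
  qed
  have B1: "c \<in> B 1 p n \<longleftrightarrow> (\<exists>y z. c = y + D z \<and> y \<in> ?F (p + e) n \<and> z \<in> ?F p (n - e))" for c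
    by (simp add: B_iff Z0)
  have "add_group (Z 1 p n) Mod B 1 p n \<cong> add_group {c \<in> ?C n. DT c = 0} Mod (DT ` ?C (n - e))"
  proof (rule add_group_Mod_iso[where f = f])
    show "f (x + y) = f x + f y" for x y by (rule f_add)
    fix x assume x: "x \<in> Z 1 p n"
    then show "f x \<in> {c \<in> ?C n. DT c = 0}" using f_C Z1 by blast
    have xF: "x \<in> ?F p n" using x Z1 by blast
    show "f x \<in> DT ` ?C (n - e) \<longleftrightarrow> x \<in> B 1 p n"
    proof
      assume "f x \<in> DT ` ?C (n - e)"
      then obtain z where z: "z \<in> ?C (n - e)" "f x = DT z" by blast
      have zF: "z \<in> ?F p (n - e)" using C_F z m by blast
      have "f (x - D z) = 0"
        using f_D[OF zF] f_id[OF z(1)] m z(2) by (simp add: f_diff)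
      moreover have "x - D z \<in> ?F p n" using F_diff[OF xF, of "D z"] D_F[OF zF] by simp
      ultimately have "x - D z \<in> ?F (p + e) n" using f_eq_0 m by blast
      then show "x \<in> B 1 p n" unfolding B1 using zF by (intro exI[of _ "x - D z"] exI[of _ z]) simp
    next
      assume "x \<in> B 1 p n"
      then obtain y z where yz: "x = y + D z" "y \<in> ?F (p + e) n" "z \<in> ?F p (n - e)"
        unfolding B1 by blast
      have "y \<in> ?F p n" using yz F_decreasing by blast
      then have "f y = 0" using f_eq_0 yz m by blast
      then have "f x = DT (f z)" using f_D[OF yz(3)] m by (simp add: yz f_add)
      then show "f x \<in> DT ` ?C (n - e)" using f_C[OF yz(3)] by blast
    qed
  next
    fix y assume y: "y \<in> {c \<in> ?C n. DT c = 0}"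
    then have "y \<in> Z 1 p n" "f y = y" using f_id[of y n] C_F[of y n] m unfolding Z1 by auto
    moreover have "0 \<in> DT ` ?C (n - e)" by (rule diff_closed_zero[OF T.diff_closed_boundaries])
    ultimately show "\<exists>x\<in>Z 1 p n. y - f x \<in> DT ` ?C (n - e)" by (intro bexI[of _ y]) auto
  qed (intro diff_closed_Z diff_closed_B B_subset_Z T.diff_closed_cycles T.diff_closed_boundaries
      T.boundaries_subset_cycles order_refl)+
  then show ?thesis by (simp add: page_eq homology_of_complex_def)
qed

text \<open>No simplex is added at such a step, so \<open>first_page_iso\<close> applies with the
  empty family as \<open>AT\<close>.\<close>

lemma first_page_trivial:
  assumes "Bs (p + e) = Bs p" and e: "\<bar>e\<bar> \<le> 1" and n: "n < int q"
  shows "trivial_group (E 1 p (n - p))"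
proof -
  let ?D = "incidence_diff R i {} :: ('a set \<Rightarrow> 'g) \<Rightarrow> 'a set \<Rightarrow> 'g"
  have T: "incidence e R i {} ?D" using nonempty by unfold_locales auto
  then interpret T: incidence e R i "{}" ?D .
  have "E 1 p (n - p) \<cong> T.H n"
    using assms by (intro first_page_iso[OF T]) auto
  moreover have "trivial_group (T.H n)" by (rule T.trivial_group_H_no_simplices) simp
  ultimately show ?thesis
    using isomorphic_group_triviality[of "E 1 p (n - p)" "T.H n"] comm_group_page[of 1] T.comm_group_H
    by (simp add: comm_group_def)
qed

end

section \<open>Simplices and their vertices\<close>

text \<open>The passage to combinatorics: for simplices, faces become subsets of vertices, and
  facets become subsets missing one vertex.\<close>

definition verts :: "'a::euclidean_space set \<Rightarrow> 'a set" where
  "verts \<sigma> = {v. v extreme_point_of \<sigma>}"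

lemma verts_convex_hull: "\<not> affine_dependent C \<Longrightarrow> verts (convex hull C) = C"
  by (simp add: verts_def extreme_point_of_convex_hull_affine_independent)

lemma simplex_verts:
  assumes "n simplex \<sigma>"
  shows "\<not> affine_dependent (verts \<sigma>)" "convex hull (verts \<sigma>) = \<sigma>" "finite (verts \<sigma>)"
    "aff_dim \<sigma> = int (card (verts \<sigma>)) - 1"
proof -
  obtain C where C: "\<not> affine_dependent C" "\<sigma> = convex hull C"
    using assms by (auto simp: simplex_def)
  then have V: "verts \<sigma> = C" by (simp add: verts_convex_hull)
  show "\<not> affine_dependent (verts \<sigma>)" "convex hull (verts \<sigma>) = \<sigma>" using C V by simp_all
  show "finite (verts \<sigma>)" using C V by (simp add: aff_independent_finite)
  show "aff_dim \<sigma> = int (card (verts \<sigma>)) - 1"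
    unfolding V using C by (simp add: aff_dim_convex_hull affine_independent_iff_card)
qed

lemma simplex_convex_hull_subset:
  assumes "n simplex \<sigma>" "C \<subseteq> verts \<sigma>"
  shows "verts (convex hull C) = C" "convex hull C face_of \<sigma>" "\<exists>m. m simplex (convex hull C)"
proof -
  have C: "\<not> affine_dependent C"
    using simplex_verts(1)[OF assms(1)] assms(2) affine_dependent_subset by blast
  then show "verts (convex hull C) = C" by (rule verts_convex_hull)
  show "convex hull C face_of \<sigma>"
    using face_of_convex_hull_affine_independent[OF simplex_verts(1)[OF assms(1)]]
      simplex_verts(2)[OF assms(1)] assms(2) by auto
  show "\<exists>m. m simplex (convex hull C)"
    using C simplex_convex_hull[of C "int (card C) - 1"] by auto
qed

lemma face_of_simplexE:
  assumes "n simplex \<sigma>" "\<tau> face_of \<sigma>"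
  shows "verts \<tau> \<subseteq> verts \<sigma>" "\<exists>m. m simplex \<tau>"
proof -
  obtain C where C: "C \<subseteq> verts \<sigma>" "\<tau> = convex hull C"
    using face_of_convex_hull_affine_independent[OF simplex_verts(1)[OF assms(1)], of \<tau>]
      simplex_verts(2)[OF assms(1)] assms(2) by auto
  then show "verts \<tau> \<subseteq> verts \<sigma>" "\<exists>m. m simplex \<tau>"
    using simplex_convex_hull_subset[OF assms(1) C(1)] by auto
qed

lemma face_of_simplex_iff:
  assumes "n simplex \<sigma>" "m simplex \<tau>"
  shows "\<tau> face_of \<sigma> \<longleftrightarrow> verts \<tau> \<subseteq> verts \<sigma>"
  using face_of_simplexE(1)[OF assms(1)] simplex_convex_hull_subset(2)[OF assms(1)]
    simplex_verts(2)[OF assms(2)] by metis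

lemma subset_simplex_iff:
  assumes "n simplex \<upsilon>" "\<sigma> face_of \<upsilon>" "\<tau> face_of \<upsilon>"
  shows "\<tau> \<subseteq> \<sigma> \<longleftrightarrow> verts \<tau> \<subseteq> verts \<sigma>"
proof
  obtain k m where km: "k simplex \<sigma>" "m simplex \<tau>"
    using face_of_simplexE(2)[OF assms(1)] assms by blast
  show "verts \<tau> \<subseteq> verts \<sigma>" if "\<tau> \<subseteq> \<sigma>"
  proof -
    have "\<tau> face_of \<sigma>" using face_of_subset[OF assms(3) that face_of_imp_subset[OF assms(2)]] .
    then show ?thesis using face_of_simplexE(1) km by blast
  qed
  show "\<tau> \<subseteq> \<sigma>" if "verts \<tau> \<subseteq> verts \<sigma>"
    using hull_mono[OF that, of convex] simplex_verts(2) km by metis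
qed

text \<open>Non-emptiness is part of the criterion because \<open>facet_of\<close> excludes the
  empty face; this is what makes the homology unreduced.\<close>

lemma facet_of_simplex_iff:
  assumes "n simplex \<sigma>" "m simplex \<tau>"
  shows "\<tau> facet_of \<sigma> \<longleftrightarrow> verts \<tau> \<noteq> {} \<and> (\<exists>w. w \<notin> verts \<tau> \<and> verts \<sigma> = insert w (verts \<tau>))"
proof -
  note s = simplex_verts[OF assms(1)] and t = simplex_verts[OF assms(2)]
  have ne: "\<tau> \<noteq> {} \<longleftrightarrow> verts \<tau> \<noteq> {}" using t(2) by (metis convex_hull_eq_empty)
  have eq: "\<tau> = convex hull (verts \<sigma> - {u}) \<longleftrightarrow> verts \<tau> = verts \<sigma> - {u}" for u
    using simplex_convex_hull_subset(1)[OF assms(1), of "verts \<sigma> - {u}"] t(2) by auto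
  have "\<tau> facet_of \<sigma> \<longleftrightarrow> \<tau> \<noteq> {} \<and> (\<exists>u. u \<in> verts \<sigma> \<and> \<tau> = convex hull (verts \<sigma> - {u}))"
    using facet_of_convex_hull_affine_independent[OF s(1), of \<tau>] s(2) by simp
  also have "\<dots> \<longleftrightarrow> verts \<tau> \<noteq> {} \<and> (\<exists>u. u \<in> verts \<sigma> \<and> verts \<tau> = verts \<sigma> - {u})"
    unfolding ne eq ..
  also have "(\<exists>u. u \<in> verts \<sigma> \<and> verts \<tau> = verts \<sigma> - {u}) \<longleftrightarrow>
      (\<exists>w. w \<notin> verts \<tau> \<and> verts \<sigma> = insert w (verts \<tau>))"
    by (intro arg_cong[where f = Ex] ext) auto
  finally show ?thesis .
qed

text \<open>Needed because \<open>omitted_position\<close> tests whether \<open>w\<close> is a point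
  of \<open>\<tau>\<close>, not whether it is a vertex of \<open>\<tau>\<close>.\<close>

lemma simplex_vertex_in_face:
  assumes "n simplex \<sigma>" "m simplex \<tau>" "verts \<tau> \<subseteq> verts \<sigma>" "w \<in> verts \<sigma>"
  shows "w \<in> \<tau> \<longleftrightarrow> w \<in> verts \<tau>"
proof
  assume "w \<in> verts \<tau>"
  then show "w \<in> \<tau>" by (simp add: verts_def extreme_point_of_def)
next
  assume w: "w \<in> \<tau>"
  have "{w} face_of \<sigma>" using assms(4) by (simp add: verts_def face_of_singleton)
  then have "{w} face_of \<tau>"
    using w assms face_of_simplex_iff[OF assms(1,2)] face_of_imp_subset
    by (intro face_of_subset[of "{w}" \<sigma> \<tau>]) auto
  then show "w \<in> verts \<tau>" by (simp add: verts_def face_of_singleton)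
qed

lemma omitted_position_eq:
  assumes "n simplex \<sigma>" "m simplex \<tau>" "verts \<sigma> = insert w (verts \<tau>)" "w \<notin> verts \<tau>"
  shows "omitted_position \<nu> \<sigma> \<tau> = card {u \<in> verts \<tau>. \<nu> u < \<nu> w}"
proof -
  have "v extreme_point_of \<sigma> \<and> v \<notin> \<tau> \<longleftrightarrow> v = w" for v
    using simplex_vertex_in_face[OF assms(1,2), of v] assms(3,4) by (auto simp: verts_def)
  then have "(\<exists>v. v extreme_point_of \<sigma> \<and> v \<notin> \<tau> \<and> \<nu> u < \<nu> v) \<longleftrightarrow> \<nu> u < \<nu> w" for u
    by metis
  then show ?thesis
    unfolding omitted_position_def verts_def by simp
qed

section \<open>The boundary and the coboundary of a family of simplices\<close>

text \<open>\<open>A\<close> need not be a subcomplex: the skeleton of a relative complex and the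
  simplices of a tile are only closed under intermediate faces. \<open>interval\<close> ensures that
  the two terms cancelling in the square of the differential are present together.\<close>

locale simplex_family =
  fixes K :: "'a::euclidean_space set set" and \<nu> :: "'a \<Rightarrow> nat" and A :: "'a set set"
  assumes K: "simplicial_complex K" and \<nu>: "inj_on \<nu> {v. {v} \<in> K}" and A_K: "A \<subseteq> K"
    and interval: "\<rho> \<in> A \<Longrightarrow> \<sigma> \<in> A \<Longrightarrow> \<rho> facet_of \<tau> \<Longrightarrow> \<tau> facet_of \<sigma> \<Longrightarrow> \<tau> \<in> A"
begin

lemma finite_A: "finite A"
  using finite_subset[OF A_K] K by (simp add: simplicial_complex_def)

lemma simplex_A: "\<sigma> \<in> A \<Longrightarrow> \<exists>n. n simplex \<sigma>"
  using K A_K unfolding simplicial_complex_def by blast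

lemma facet_iff:
  "\<sigma> \<in> A \<Longrightarrow> \<tau> \<in> A \<Longrightarrow>
    \<tau> facet_of \<sigma> \<longleftrightarrow> verts \<tau> \<noteq> {} \<and> (\<exists>w. w \<notin> verts \<tau> \<and> verts \<sigma> = insert w (verts \<tau>))"
  using facet_of_simplex_iff[of _ \<sigma> _ \<tau>] simplex_A[of \<sigma>] simplex_A[of \<tau>] by auto

lemma eq_iff_verts: "\<sigma> \<in> A \<Longrightarrow> \<tau> \<in> A \<Longrightarrow> \<sigma> = \<tau> \<longleftrightarrow> verts \<sigma> = verts \<tau>"
  using simplex_verts(2)[of _ \<sigma>] simplex_verts(2)[of _ \<tau>] simplex_A[of \<sigma>] simplex_A[of \<tau>] by metis

lemma position_eq:
  "\<sigma> \<in> A \<Longrightarrow> \<tau> \<in> A \<Longrightarrow> verts \<sigma> = insert w (verts \<tau>) \<Longrightarrow> w \<notin> verts \<tau> \<Longrightarrow>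
    omitted_position \<nu> \<sigma> \<tau> = card {u \<in> verts \<tau>. \<nu> u < \<nu> w}"
  using omitted_position_eq[of _ \<sigma> _ \<tau>] simplex_A[of \<sigma>] simplex_A[of \<tau>] by blast

lemma vertex_K: "\<sigma> \<in> A \<Longrightarrow> v \<in> verts \<sigma> \<Longrightarrow> {v} \<in> K"
  using K A_K unfolding simplicial_complex_def verts_def face_of_singleton[symmetric] by blast

text \<open>The vertex \<open>a\<close> is preceded by the same vertices in \<open>\<tau>\<close>
  and in \<open>\<sigma>\<close>. The larger vertex \<open>b\<close> has \<open>a\<close> before it
  in \<open>\<sigma>\<close> but not in \<open>\<tau>'\<close>, and this extra one makes the signs
  of the two paths opposite.\<close>

lemma position_sum:
  assumes \<rho>: "\<rho> \<in> A" and \<sigma>: "\<sigma> \<in> A" and \<tau>: "\<tau> \<in> A" "\<tau>' \<in> A"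
    and a: "a \<notin> verts \<rho>" and b: "b \<notin> verts \<rho>" and ab: "\<nu> a < \<nu> b"
    and v: "verts \<tau> = insert a (verts \<rho>)" "verts \<tau>' = insert b (verts \<rho>)"
      "verts \<sigma> = insert a (insert b (verts \<rho>))"
  shows "omitted_position \<nu> \<tau> \<rho> + omitted_position \<nu> \<sigma> \<tau> =
    Suc (omitted_position \<nu> \<tau>' \<rho> + omitted_position \<nu> \<sigma> \<tau>')"
proof -
  have fin: "finite (verts \<rho>)" using simplex_A[OF \<rho>] simplex_verts(3) by blast
  have ne: "a \<noteq> b" using ab by auto
  have "{u \<in> insert a (verts \<rho>). \<nu> u < \<nu> b} = insert a {u \<in> verts \<rho>. \<nu> u < \<nu> b}"
    "{u \<in> insert b (verts \<rho>). \<nu> u < \<nu> a} = {u \<in> verts \<rho>. \<nu> u < \<nu> a}"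
    using ab by auto
  moreover have "omitted_position \<nu> \<sigma> \<tau> = card {u \<in> verts \<tau>. \<nu> u < \<nu> b}"
    using v b ne by (intro position_eq[OF \<sigma> \<tau>(1)]) auto
  moreover have "omitted_position \<nu> \<sigma> \<tau>' = card {u \<in> verts \<tau>'. \<nu> u < \<nu> a}"
    using v a ne by (intro position_eq[OF \<sigma> \<tau>(2)]) auto
  ultimately show ?thesis
    using fin a by (simp add: position_eq[OF \<tau>(1) \<rho> v(1) a] position_eq[OF \<tau>(2) \<rho> v(2) b] v(1,2))
qed

text \<open>Two simplices whose dimensions differ by \<open>2\<close> have exactly two intermediate simplices.\<close>

lemma cancel:
  assumes \<rho>: "\<rho> \<in> A" and \<sigma>: "\<sigma> \<in> A"
  shows "(\<Sum>\<tau> | \<tau> \<in> A \<and> \<rho> facet_of \<tau> \<and> \<tau> facet_of \<sigma>.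
    signed (omitted_position \<nu> \<tau> \<rho> + omitted_position \<nu> \<sigma> \<tau>) (g :: 'g::ab_group_add)) = 0" (is "sum ?f ?M = 0")
proof (cases "?M = {}")
  case False
  then obtain \<tau> where \<tau>: "\<tau> \<in> A" "\<rho> facet_of \<tau>" "\<tau> facet_of \<sigma>" by auto
  obtain a where a: "a \<notin> verts \<rho>" "verts \<tau> = insert a (verts \<rho>)" and ne: "verts \<rho> \<noteq> {}"
    using facet_iff[OF \<tau>(1) \<rho>] \<tau>(2) by blast
  obtain b where b: "b \<notin> verts \<tau>" "verts \<sigma> = insert b (verts \<tau>)"
    using facet_iff[OF \<sigma> \<tau>(1)] \<tau>(3) by blast
  \<comment> \<open>The other way from \<open>\<rho>\<close> to \<open>\<sigma>\<close>: insert
    \<open>b\<close> before \<open>a\<close>. It lies in \<open>A\<close> by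
    \<open>interval\<close>.\<close>
  define \<tau>' where "\<tau>' = convex hull (insert b (verts \<rho>))"
  obtain n where n: "n simplex \<sigma>" using simplex_A[OF \<sigma>] by blast
  obtain k where k: "k simplex \<rho>" using simplex_A[OF \<rho>] by blast
  have "insert b (verts \<rho>) \<subseteq> verts \<sigma>" using a b by auto
  from simplex_convex_hull_subset[OF n this]
  obtain m where m: "m simplex \<tau>'" and v': "verts \<tau>' = insert b (verts \<rho>)" by (auto simp: \<tau>'_def)
  have "\<rho> facet_of \<tau>'"
    unfolding facet_of_simplex_iff[OF m k] v' using ne a b by (intro conjI exI[of _ b]) auto
  moreover have "\<tau>' facet_of \<sigma>"
    unfolding facet_of_simplex_iff[OF n m] v' using a b by (intro conjI exI[of _ a]) auto
  ultimately have \<tau>': "\<tau>' \<in> A" "\<rho> facet_of \<tau>'" "\<tau>' facet_of \<sigma>"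
    using interval[OF \<rho> \<sigma>, of \<tau>'] by blast+
  have "\<tau>'' = \<tau> \<or> \<tau>'' = \<tau>'" if \<tau>'': "\<tau>'' \<in> A" "\<rho> facet_of \<tau>''" "\<tau>'' facet_of \<sigma>" for \<tau>''
  proof -
    obtain c where c: "c \<notin> verts \<rho>" "verts \<tau>'' = insert c (verts \<rho>)"
      using facet_iff[OF \<tau>''(1) \<rho>] \<tau>''(2) by blast
    have "c \<in> verts \<sigma>" using facet_iff[OF \<sigma> \<tau>''(1)] \<tau>''(3) c by blast
    then have "c = a \<or> c = b" using a b c by auto
    then show ?thesis using eq_iff_verts[OF \<tau>''(1) \<tau>(1)] eq_iff_verts[OF \<tau>''(1) \<tau>'(1)] a c v' by auto
  qed
  then have M: "?M = {\<tau>, \<tau>'}" using \<tau> \<tau>' by blast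
  have ne': "\<tau> \<noteq> \<tau>'" using a b v' by auto
  have "{a} \<in> K" "{b} \<in> K" using vertex_K[OF \<sigma>] a b by auto
  moreover have "a \<noteq> b" using a b by auto
  ultimately have "\<nu> a \<noteq> \<nu> b" using \<nu> by (auto simp: inj_on_def)
  then consider "\<nu> a < \<nu> b" | "\<nu> b < \<nu> a" by linarith
  then have "?f \<tau> + ?f \<tau>' = 0"
  proof cases
    case 1
    from position_sum[OF \<rho> \<sigma> \<tau>(1) \<tau>'(1) a(1) _ 1 a(2) v'] show ?thesis
      using a b by (auto simp: signed_Suc insert_commute)
  next
    case 2
    from position_sum[OF \<rho> \<sigma> \<tau>'(1) \<tau>(1) _ a(1) 2 v' a(2)] show ?thesis
      using a b by (auto simp: signed_Suc insert_commute)
  qed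
  then show ?thesis unfolding M using ne' by simp
next
  case True
  then show ?thesis by (simp only: sum.empty)
qed

lemma facet_of_nonempty: "\<tau> facet_of \<sigma> \<Longrightarrow> \<tau> \<noteq> {}" "\<tau> facet_of \<sigma> \<Longrightarrow> \<sigma> \<noteq> {}"
  by (auto simp: facet_of_def dest: face_of_imp_subset)

lemma facet_aff_dim: "\<tau> facet_of \<sigma> \<Longrightarrow> aff_dim \<tau> = aff_dim \<sigma> + -1" "\<tau> facet_of \<sigma> \<Longrightarrow> aff_dim \<sigma> = aff_dim \<tau> + 1"
  by (auto simp: facet_of_def)

lemma incidence_boundary:
  "incidence (-1) (\<lambda>\<tau> \<sigma>. \<tau> facet_of \<sigma>) (\<lambda>\<tau> \<sigma>. omitted_position \<nu> \<sigma> \<tau>) A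
    (simplicial_boundary \<nu> A :: ('a set \<Rightarrow> 'g::ab_group_add) \<Rightarrow> _)"
proof
  show "simplicial_boundary \<nu> A =
      (incidence_diff (\<lambda>\<tau> \<sigma>. \<tau> facet_of \<sigma>) (\<lambda>\<tau> \<sigma>. omitted_position \<nu> \<sigma> \<tau>) A :: ('a set \<Rightarrow> 'g) \<Rightarrow> _)"
    by (rule simplicial_boundary_eq)
  show "(\<Sum>\<tau> | \<tau> \<in> A \<and> \<rho> facet_of \<tau> \<and> \<tau> facet_of \<sigma>.
      signed (omitted_position \<nu> \<tau> \<rho>) (signed (omitted_position \<nu> \<sigma> \<tau>) g)) = 0"
    if "\<rho> \<in> A" "\<sigma> \<in> A" for \<rho> \<sigma> and g :: 'g
    using cancel[OF that] by (simp add: signed_signed)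
qed (use finite_A facet_of_nonempty facet_aff_dim in blast)+

lemma incidence_coboundary:
  "incidence 1 (\<lambda>\<sigma> \<tau>. \<tau> facet_of \<sigma>) (\<lambda>\<sigma> \<tau>. omitted_position \<nu> \<sigma> \<tau>) A
    (simplicial_coboundary \<nu> A :: ('a set \<Rightarrow> 'g::ab_group_add) \<Rightarrow> _)"
proof
  show "simplicial_coboundary \<nu> A =
      (incidence_diff (\<lambda>\<sigma> \<tau>. \<tau> facet_of \<sigma>) (\<lambda>\<sigma> \<tau>. omitted_position \<nu> \<sigma> \<tau>) A :: ('a set \<Rightarrow> 'g) \<Rightarrow> _)"
    by (rule simplicial_coboundary_eq)
  show "(\<Sum>\<tau> | \<tau> \<in> A \<and> \<tau> facet_of \<sigma> \<and> \<rho> facet_of \<tau>.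
      signed (omitted_position \<nu> \<sigma> \<tau>) (signed (omitted_position \<nu> \<tau> \<rho>) g)) = 0"
    if "\<sigma> \<in> A" "\<rho> \<in> A" for \<rho> \<sigma> and g :: 'g
  proof -
    have "{\<tau>. \<tau> \<in> A \<and> \<tau> facet_of \<sigma> \<and> \<rho> facet_of \<tau>} = {\<tau>. \<tau> \<in> A \<and> \<rho> facet_of \<tau> \<and> \<tau> facet_of \<sigma>}"
      by blast
    then show ?thesis
      using cancel[OF that(2,1), of g] by (simp only: signed_signed add.commute)
  qed
qed (use finite_A facet_of_nonempty facet_aff_dim in blast)+

text \<open>Inserting \<open>v\<close> matches the simplices without \<open>v\<close> with those
  containing it. A facet without \<open>v\<close> of a simplex containing \<open>v\<close> can only
  arise by omitting \<open>v\<close>, so the component of the differential between the two halves is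
  diagonal, as \<open>trivial_group_H\<close> requires.\<close>

lemma acyclic_family:
  assumes ne: "{} \<notin> A"
    and add: "\<And>\<sigma>. \<sigma> \<in> A \<Longrightarrow> v \<notin> verts \<sigma> \<Longrightarrow> \<exists>\<tau>\<in>A. verts \<tau> = insert v (verts \<sigma>)"
    and del: "\<And>\<sigma>. \<sigma> \<in> A \<Longrightarrow> v \<in> verts \<sigma> \<Longrightarrow> \<exists>\<tau>\<in>A. verts \<tau> = verts \<sigma> - {v}"
  shows "trivial_group (homology_of_complex (-1) (simplicial_chains A)
      (simplicial_boundary \<nu> A :: ('a set \<Rightarrow> 'g::ab_group_add) \<Rightarrow> _) n)" (is ?thesis1)
    and "trivial_group (homology_of_complex 1 (simplicial_chains A)
      (simplicial_coboundary \<nu> A :: ('a set \<Rightarrow> 'g::ab_group_add) \<Rightarrow> _) n)" (is ?thesis2)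
proof -
  define A1 A2 where "A1 = {\<sigma> \<in> A. v \<notin> verts \<sigma>}" and "A2 = {\<sigma> \<in> A. v \<in> verts \<sigma>}"
  have A: "A = A1 \<union> A2" "A1 \<inter> A2 = {}" "A = A2 \<union> A1" "A2 \<inter> A1 = {}"
    by (auto simp: A1_def A2_def)
  have verts_ne: "verts \<sigma> \<noteq> {}" if "\<sigma> \<in> A" for \<sigma>
    using that ne simplex_A[OF that] simplex_verts(2) by (metis convex_hull_eq_empty)
  have "\<forall>\<sigma>\<in>A1. \<exists>\<tau>. \<tau> \<in> A \<and> verts \<tau> = insert v (verts \<sigma>)"
    using add by (auto simp: A1_def)
  from bchoice[OF this] obtain m
    where m: "\<And>\<sigma>. \<sigma> \<in> A1 \<Longrightarrow> m \<sigma> \<in> A \<and> verts (m \<sigma>) = insert v (verts \<sigma>)" by blast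
  have "\<forall>\<sigma>\<in>A2. \<exists>\<tau>. \<tau> \<in> A \<and> verts \<tau> = verts \<sigma> - {v}"
    using del by (auto simp: A2_def)
  from bchoice[OF this] obtain m'
    where m': "\<And>\<sigma>. \<sigma> \<in> A2 \<Longrightarrow> m' \<sigma> \<in> A \<and> verts (m' \<sigma>) = verts \<sigma> - {v}" by blast
  have mA2: "m \<sigma> \<in> A2" if "\<sigma> \<in> A1" for \<sigma> using m[OF that] by (simp add: A2_def)
  have m'A1: "m' \<sigma> \<in> A1" if "\<sigma> \<in> A2" for \<sigma> using m'[OF that] by (simp add: A1_def)
  have m'm: "m' (m \<sigma>) = \<sigma>" if "\<sigma> \<in> A1" for \<sigma>
    using that m[OF that] m'[OF mA2[OF that]] eq_iff_verts[of "m' (m \<sigma>)" \<sigma>] by (auto simp: A1_def)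
  have mm': "m (m' \<sigma>) = \<sigma>" if "\<sigma> \<in> A2" for \<sigma>
    using that m'[OF that] m[OF m'A1[OF that]] eq_iff_verts[of "m (m' \<sigma>)" \<sigma>]
    by (auto simp: A2_def)
  have bij: "bij_betw m A1 A2"
    by (rule bij_betw_byWitness[where f' = m']) (auto simp: mA2 m'A1 m'm mm')
  have bij': "bij_betw m' A2 A1"
    by (rule bij_betw_byWitness[where f' = m]) (auto simp: mA2 m'A1 m'm mm')
  have facet: "\<tau> facet_of \<sigma> \<longleftrightarrow> \<sigma> = m \<tau>" if "\<tau> \<in> A1" "\<sigma> \<in> A2" for \<tau> \<sigma>
  proof -
    have "\<tau> \<in> A" "\<sigma> \<in> A" "v \<notin> verts \<tau>" "v \<in> verts \<sigma>" using that by (auto simp: A1_def A2_def)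
    then show ?thesis
      using facet_iff[of \<sigma> \<tau>] verts_ne[of \<tau>] m[OF that(1)] eq_iff_verts[of \<sigma> "m \<tau>"] by auto
  qed
  have facet': "\<tau> facet_of \<sigma> \<longleftrightarrow> \<tau> = m' \<sigma>" if "\<tau> \<in> A1" "\<sigma> \<in> A2" for \<tau> \<sigma>
    using facet[OF that] m'm[OF that(1)] mm'[OF that(2)] by metis
  \<comment> \<open>The boundary leads from \<open>A2\<close> to \<open>A1\<close> and the
    coboundary from \<open>A1\<close> to \<open>A2\<close>, so the halves and the matching are
    exchanged in the second case.\<close>
  show ?thesis1
    by (rule incidence.trivial_group_H[OF incidence_boundary A(1,2) ne bij facet])
  show ?thesis2
    by (rule incidence.trivial_group_H[OF incidence_coboundary A(3,4) ne bij' facet'])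
qed

end

section \<open>The simplices of a Morse tile\<close>

lemma rel_interior_simplex_nonempty: "n simplex \<sigma> \<Longrightarrow> \<sigma> \<noteq> {} \<Longrightarrow> rel_interior \<sigma> \<noteq> {}"
  by (simp add: rel_interior_eq_empty convex_simplex)

text \<open>The family on which the chains computing \<open>tile_homology\<close> and
  \<open>tile_cohomology\<close> live.\<close>

definition tile_simplices :: "'a::euclidean_space tile \<Rightarrow> 'a set set" where
  "tile_simplices T = closed_complex T - removed_complex T"

lemma tile_simplices_iff: "\<sigma> \<in> tile_simplices T \<longleftrightarrow> \<sigma> face_of underlying T \<and> \<sigma> \<inter> tile_points T \<noteq> {}"
proof -
  have "\<sigma> face_of underlying T \<Longrightarrow> \<sigma> \<subseteq> underlying T" by (rule face_of_imp_subset)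
  then show ?thesis
    unfolding tile_simplices_def closed_complex_def removed_complex_def by blast
qed

lemma morse_tile_simplex: "morse_tile T \<Longrightarrow> \<exists>n\<ge>0. n simplex underlying T"
  by (simp add: morse_tile_def)

lemma morse_tile_faces:
  assumes "morse_tile T" "F \<in> insert (morse_face T) (removed_faces T)"
  shows "F face_of underlying T"
  using assms unfolding morse_tile_def by auto

text \<open>Counting the Morse face among the faces to be removed gives a single condition on the
  simplices of the tile. When it is empty, it excludes just the empty simplex.\<close>

lemma tile_points_eq: "tile_points T = underlying T - \<Union>(insert (morse_face T) (removed_faces T))"
  by (auto simp: tile_points_def)

text \<open>A face of the underlying simplex contained in a union of faces is contained in one of them.\<close>

lemma
  assumes T: "morse_tile T" and \<sigma>: "\<sigma> face_of underlying T"
  shows tile_simplices_iff_faces: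
      "\<sigma> \<in> tile_simplices T \<longleftrightarrow> (\<forall>F\<in>insert (morse_face T) (removed_faces T). \<not> \<sigma> \<subseteq> F)" (is "_ \<longleftrightarrow> ?F")
    and tile_simplices_rel_interior: "\<sigma> \<in> tile_simplices T \<Longrightarrow> rel_interior \<sigma> \<subseteq> tile_points T"
proof -
  obtain n where n: "n simplex underlying T" using morse_tile_simplex[OF T] by blast
  obtain m where m: "m simplex \<sigma>" using face_of_simplexE(2)[OF n \<sigma>] by blast
  have sub: "\<sigma> \<subseteq> underlying T" using \<sigma> by (rule face_of_imp_subset)
  have 1: ?F if "\<sigma> \<in> tile_simplices T"
    using that unfolding tile_simplices_iff tile_points_eq by blast
  have 2: "rel_interior \<sigma> \<subseteq> tile_points T" if F: ?F
  proof
    fix x assume x: "x \<in> rel_interior \<sigma>"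
    \<comment> \<open>A face containing a relative interior point of \<open>\<sigma>\<close>
      contains all of \<open>\<sigma>\<close>.\<close>
    have "x \<notin> F" if "F \<in> insert (morse_face T) (removed_faces T)" for F
      using subset_of_face_of[OF morse_tile_faces[OF T that] sub] x F that by blast
    then show "x \<in> tile_points T"
      unfolding tile_points_eq using x rel_interior_subset sub by blast
  qed
  have "\<sigma> \<in> tile_simplices T" if F: ?F
  proof -
    have "\<sigma> \<noteq> {}" using F by blast
    then obtain x where "x \<in> rel_interior \<sigma>" using rel_interior_simplex_nonempty[OF m] by blast
    then have "x \<in> \<sigma> \<inter> tile_points T" using 2[OF F] rel_interior_subset by blast
    then show ?thesis using \<sigma> by (auto simp: tile_simplices_iff)
  qed
  then show "\<sigma> \<in> tile_simplices T \<longleftrightarrow> ?F" using 1 by blast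
  show "\<sigma> \<in> tile_simplices T \<Longrightarrow> rel_interior \<sigma> \<subseteq> tile_points T" using 1 2 by blast
qed

text \<open>All faces taken away have smaller dimension. In particular a tile always has points,
  which makes tiles of a partition distinguishable by their points.\<close>

lemma underlying_in_tile_simplices:
  assumes T: "morse_tile T" shows "underlying T \<in> tile_simplices T"
proof -
  obtain n where n: "0 \<le> n" "n simplex underlying T" using morse_tile_simplex[OF T] by blast
  have self: "underlying T face_of underlying T"
    using n(2) by (simp add: face_of_refl convex_simplex)
  have "\<not> underlying T \<subseteq> F" if F: "F \<in> insert (morse_face T) (removed_faces T)" for F
  proof
    assume "underlying T \<subseteq> F"
    moreover have "F \<subseteq> underlying T" using morse_tile_faces[OF T F] by (rule face_of_imp_subset)
    ultimately have eq: "F = underlying T" by blast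
    have "aff_dim F = tile_dim T - 1 \<or> aff_dim F < tile_dim T - 1 \<or> F = {}"
      using T F unfolding morse_tile_def by blast
    then have "aff_dim F \<noteq> aff_dim (underlying T)"
      using aff_dim_simplex[OF n(2)] n(1) by (auto simp: tile_dim_def)
    then show False using eq by simp
  qed
  then show ?thesis unfolding tile_simplices_iff_faces[OF T self] by blast
qed

text \<open>Counting vertices by \<open>aff_dim\<close> also covers a point, whose codimension one
  face is empty.\<close>

lemma removed_face_verts:
  assumes T: "morse_tile T" and F: "F \<in> removed_faces T"
  shows "\<exists>r\<in>verts (underlying T). verts F = verts (underlying T) - {r}"
proof -
  obtain n where n: "n simplex underlying T" using morse_tile_simplex[OF T] by blast
  have face: "F face_of underlying T" and dim: "aff_dim F = aff_dim (underlying T) - 1"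
    using T F unfolding morse_tile_def tile_dim_def by blast+
  obtain m where m: "m simplex F" using face_of_simplexE(2)[OF n face] by blast
  have sub: "verts F \<subseteq> verts (underlying T)" using face_of_simplexE(1)[OF n face] .
  have fin: "finite (verts (underlying T))" using simplex_verts(3)[OF n] .
  have "int (card (verts F)) + 1 = int (card (verts (underlying T)))"
    using simplex_verts(4)[OF n] simplex_verts(4)[OF m] dim by simp
  then have "card (verts (underlying T) - verts F) = 1"
    using sub fin by (simp add: card_Diff_subset finite_subset)
  then obtain r where "verts (underlying T) - verts F = {r}" by (auto simp: card_1_singleton_iff)
  then show ?thesis using sub by (intro bexI[of _ r]) auto
qed

text \<open>Adding or deleting such a vertex \<open>v\<close> does not change whether a face of the underlying simplex
  belongs to the tile. If the removed faces are opposite to the vertices in \<open>R\<close>, then \<open>v\<close> is any vertex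
  outside \<open>R\<close>, taken in the Morse face if that is non-empty; there is none only for critical tiles.\<close>

lemma noncritical_vertex:
  assumes T: "morse_tile T" and nc: "\<not> critical T"
  shows "\<exists>v\<in>verts (underlying T). (\<forall>F\<in>removed_faces T. v \<in> verts F) \<and>
    (if morse_face T = {} then removed_faces T \<noteq> {} else v \<in> verts (morse_face T))"
proof -
  obtain n where n: "0 \<le> n" "n simplex underlying T" using morse_tile_simplex[OF T] by blast
  define V where "V = verts (underlying T)"
  \<comment> \<open>The candidates for \<open>v\<close>. Each vertex opposite to a removed face lies
    in \<open>M\<close>: a non-empty Morse face not contained in that face must have this
    vertex.\<close>
  define M where "M = (if morse_face T = {} then V else verts (morse_face T))"
  note V = simplex_verts[OF n(2), folded V_def]
  have face: "morse_face T face_of underlying T" using morse_tile_faces[OF T] by blast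
  obtain m where m: "m simplex morse_face T" using face_of_simplexE(2)[OF n(2) face] by blast
  have MV: "M \<subseteq> V"
    using face_of_simplexE(1)[OF n(2) face] unfolding M_def V_def by simp
  have removed: "\<exists>r\<in>M. F = convex hull (V - {r})" if F: "F \<in> removed_faces T" for F
  proof -
    obtain r where r: "r \<in> V" "verts F = V - {r}"
      using removed_face_verts[OF T F] by (auto simp: V_def)
    have Ff: "F face_of underlying T" using morse_tile_faces[OF T] F by blast
    obtain k where "k simplex F" using face_of_simplexE(2)[OF n(2) Ff] by blast
    then have "F = convex hull (V - {r})" using simplex_verts(2) r by metis
    moreover have "r \<in> M"
    proof (cases "morse_face T = {}")
      case False
      then have "\<not> morse_face T \<subseteq> F" using T F unfolding morse_tile_def by blast
      then have "\<not> verts (morse_face T) \<subseteq> V - {r}"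
        using subset_simplex_iff[OF n(2) Ff face] r by simp
      then show ?thesis using False face_of_simplexE(1)[OF n(2) face] by (auto simp: M_def V_def)
    qed (simp add: M_def r)
    ultimately show ?thesis by blast
  qed
  have inj: "inj_on (\<lambda>r. convex hull (V - {r})) M"
  proof (rule inj_onI)
    fix r s assume rs: "r \<in> M" "s \<in> M" "convex hull (V - {r}) = convex hull (V - {s})"
    have "verts (convex hull (V - {u})) = V - {u}" for u
      using simplex_convex_hull_subset(1)[OF n(2), of "V - {u}"] by (auto simp: V_def)
    then have "V - {r} = V - {s}" using rs(3) by metis
    then show "r = s" using rs(1,2) MV by blast
  qed
  have "\<exists>v\<in>M. \<forall>F\<in>removed_faces T. v \<in> verts F"
  proof (rule ccontr)
    assume contra: "\<not> ?thesis"
    \<comment> \<open>If every candidate is opposite to a removed face, the order equals the number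
      of vertices in \<open>M\<close>: the tile is then an open simplex, or its Morse face has
      dimension one less than its order. Either way it is critical.\<close>
    have "convex hull (V - {v}) \<in> removed_faces T" if v: "v \<in> M" for v
    proof -
      obtain F where F: "F \<in> removed_faces T" "v \<notin> verts F" using contra v by blast
      then obtain r where r: "r \<in> M" "F = convex hull (V - {r})" using removed by blast
      then have "verts F = V - {r}"
        using simplex_convex_hull_subset(1)[OF n(2), of "V - {r}"] by (auto simp: V_def)
      then have "r = v" using F v MV by blast
      then show ?thesis using F r by simp
    qed
    then have "removed_faces T = (\<lambda>r. convex hull (V - {r})) ` M" using removed by blast
    then have ord: "tile_order T = card M" unfolding tile_order_def by (simp add: card_image inj)
    show False
    proof (cases "morse_face T = {}")
      case True
      then have "int (tile_order T) = tile_dim T + 1"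
        using ord V(4) by (simp add: M_def tile_dim_def)
      moreover have "tile_dim T = int (nat n)"
        using aff_dim_simplex[OF n(2)] n(1) by (simp add: tile_dim_def)
      ultimately have "critical_of_index T (nat n)" by (simp add: critical_of_index_def)
      then show False using nc by (auto simp: critical_def)
    next
      case False
      then have "aff_dim (morse_face T) = int (tile_order T) - 1"
        using ord simplex_verts(4)[OF m] by (simp add: M_def)
      then have "critical_of_index T (tile_order T)" by (simp add: critical_of_index_def)
      then show False using nc by (auto simp: critical_def)
    qed
  qed
  then obtain v where v: "v \<in> M" "\<forall>F\<in>removed_faces T. v \<in> verts F" by blast
  \<comment> \<open>A closed simplex is critical of index 0, since
    \<open>aff_dim {} = -1\<close>.\<close>
  have "removed_faces T \<noteq> {}" if "morse_face T = {}"
  proof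
    assume "removed_faces T = {}"
    then have "critical_of_index T 0" using that by (simp add: critical_of_index_def tile_order_def)
    then show False using nc by (auto simp: critical_def)
  qed
  then show ?thesis
    using v MV unfolding M_def V_def by (intro bexI[of _ v]) (auto split: if_splits)
qed

text \<open>Inserting \<open>v\<close> cannot move a simplex into one of the faces taken away.
  Deleting \<open>v\<close> cannot either when the face contains \<open>v\<close>, as the whole
  simplex would then lie in it; the only face without \<open>v\<close> is an empty Morse
  face.\<close>

lemma noncritical_tile_homology:
  fixes \<nu> :: "'a::euclidean_space \<Rightarrow> nat"
  assumes T: "morse_tile T" and nc: "\<not> critical T" and fam: "simplex_family K \<nu> (tile_simplices T)"
  shows "trivial_group (tile_homology TYPE('g::ab_group_add) \<nu> T n)"
    and "trivial_group (tile_cohomology TYPE('g) \<nu> T n)"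
proof -
  interpret simplex_family K \<nu> "tile_simplices T" by (rule fam)
  obtain n where n: "n simplex underlying T" using morse_tile_simplex[OF T] by blast
  obtain v where v: "v \<in> verts (underlying T)" and vF: "\<And>F. F \<in> removed_faces T \<Longrightarrow> v \<in> verts F"
    and vM: "morse_face T = {} \<Longrightarrow> removed_faces T \<noteq> {}"
      "morse_face T \<noteq> {} \<Longrightarrow> v \<in> verts (morse_face T)"
    using noncritical_vertex[OF T nc] by (metis (full_types))
  let ?Fs = "insert (morse_face T) (removed_faces T)"
  have verts_sub: "verts \<sigma> \<subseteq> verts (underlying T)" if "\<sigma> \<in> tile_simplices T" for \<sigma>
    using that unfolding tile_simplices_iff by (blast dest: face_of_simplexE(1)[OF n, THEN subsetD])
  have tile_iff: "convex hull W \<in> tile_simplices T \<longleftrightarrow> (\<forall>F\<in>?Fs. \<not> W \<subseteq> verts F)"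
    if W: "W \<subseteq> verts (underlying T)" for W
  proof -
    note c = simplex_convex_hull_subset[OF n W]
    have "convex hull W \<subseteq> F \<longleftrightarrow> W \<subseteq> verts F" if "F \<in> ?Fs" for F
      using subset_simplex_iff[OF n morse_tile_faces[OF T that] c(2)] c(1) by simp
    then show ?thesis using tile_simplices_iff_faces[OF T c(2)] by blast
  qed
  have \<sigma>_iff: "\<forall>F\<in>?Fs. \<not> verts \<sigma> \<subseteq> verts F" if \<sigma>: "\<sigma> \<in> tile_simplices T" for \<sigma>
  proof -
    obtain k where "k simplex \<sigma>" using simplex_A[OF \<sigma>] by blast
    then have "convex hull (verts \<sigma>) = \<sigma>" by (rule simplex_verts(2))
    then show ?thesis using tile_iff[OF verts_sub[OF \<sigma>]] \<sigma> by simp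
  qed
  have ne: "{} \<notin> tile_simplices T" unfolding tile_simplices_iff by blast
  have add: "\<exists>\<tau>\<in>tile_simplices T. verts \<tau> = insert v (verts \<sigma>)"
    if \<sigma>: "\<sigma> \<in> tile_simplices T" for \<sigma>
  proof -
    have W: "insert v (verts \<sigma>) \<subseteq> verts (underlying T)" using v verts_sub[OF \<sigma>] by simp
    have "\<forall>F\<in>?Fs. \<not> insert v (verts \<sigma>) \<subseteq> verts F" using \<sigma>_iff[OF \<sigma>] by blast
    then have "convex hull (insert v (verts \<sigma>)) \<in> tile_simplices T" using tile_iff[OF W] by blast
    then show ?thesis using simplex_convex_hull_subset(1)[OF n W] by blast
  qed
  have del: "\<exists>\<tau>\<in>tile_simplices T. verts \<tau> = verts \<sigma> - {v}"
    if \<sigma>: "\<sigma> \<in> tile_simplices T" for \<sigma>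
  proof -
    have W: "verts \<sigma> - {v} \<subseteq> verts (underlying T)" using verts_sub[OF \<sigma>] by blast
    have R: "\<not> verts \<sigma> - {v} \<subseteq> verts F" if "F \<in> removed_faces T" for F
      using \<sigma>_iff[OF \<sigma>] vF[OF that] that by blast
    \<comment> \<open>For an empty Morse face this says that \<open>\<sigma>\<close> has a vertex
      besides \<open>v\<close>. That follows from any removed face \<open>F\<close>, because
      \<open>verts \<sigma> - {v}\<close> is not contained in \<open>verts F\<close>.\<close>
    have "\<not> verts \<sigma> - {v} \<subseteq> verts (morse_face T)"
    proof (cases "morse_face T = {}")
      case True
      then have "verts (morse_face T) = {}" by (simp add: verts_def extreme_point_of_def)
      moreover obtain F where "F \<in> removed_faces T" using vM(1)[OF True] by blast
      ultimately show ?thesis using R by blast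
    next
      case False
      then show ?thesis using \<sigma>_iff[OF \<sigma>] vM(2) by blast
    qed
    then have "convex hull (verts \<sigma> - {v}) \<in> tile_simplices T" using tile_iff[OF W] R by blast
    then show ?thesis using simplex_convex_hull_subset(1)[OF n W] by blast
  qed
  show "trivial_group (tile_homology TYPE('g) \<nu> T n)" for n
    unfolding tile_homology_def simplicial_homology_def tile_simplices_def[symmetric]
    by (rule acyclic_family(1)[OF ne add del])
  show "trivial_group (tile_cohomology TYPE('g) \<nu> T n)" for n
    unfolding tile_cohomology_def simplicial_cohomology_def tile_simplices_def[symmetric]
    by (rule acyclic_family(2)[OF ne add del])
qed

section \<open>The filtration of the skeleton by a partial shelling\<close>

locale morse_shelling =
  fixes K L :: "'a::euclidean_space set set" and P :: "'a tile set" and q N :: nat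
    and S :: "nat \<Rightarrow> 'a set" and \<nu> :: "'a \<Rightarrow> nat"
  assumes K: "simplicial_complex K" and L: "simplicial_complex L"
    and tiling: "morse_tiling K L P" and shelling: "partial_shelling K L P q N S"
    and \<nu>: "inj_on \<nu> {v. {v} \<in> K}"
begin

definition Aq :: "'a set set" where
  "Aq = skeleton q K - skeleton q L"

abbreviation "SS \<equiv> shelling_simplices K L q N S"

lemma simplex_K: "\<sigma> \<in> K \<Longrightarrow> \<exists>n. n simplex \<sigma>"
  using K unfolding simplicial_complex_def by blast

lemma face_K: "\<sigma> \<in> K \<Longrightarrow> \<tau> face_of \<sigma> \<Longrightarrow> \<tau> \<in> K"
  using K unfolding simplicial_complex_def by blast

lemma face_L: "\<sigma> \<in> L \<Longrightarrow> \<tau> face_of \<sigma> \<Longrightarrow> \<tau> \<in> L"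
  using L unfolding simplicial_complex_def by blast

lemma Int_face_K: "\<sigma> \<in> K \<Longrightarrow> \<tau> \<in> K \<Longrightarrow> \<sigma> \<inter> \<tau> face_of \<sigma>"
  using K unfolding simplicial_complex_def by blast

lemma rel_interior_nonempty: "\<sigma> \<in> K \<Longrightarrow> \<sigma> \<noteq> {} \<Longrightarrow> rel_interior \<sigma> \<noteq> {}"
  using simplex_K rel_interior_simplex_nonempty by blast

text \<open>\<open>\<sigma> \<inter> \<tau>\<close> is a face of \<open>\<sigma>\<close> that
  contains a relative interior point of \<open>\<sigma>\<close>, so it is all of
  \<open>\<sigma>\<close>.\<close>

lemma rel_interior_meets:
  assumes "\<sigma> \<in> K" "\<tau> \<in> K" "rel_interior \<sigma> \<inter> \<tau> \<noteq> {}"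
  shows "\<sigma> face_of \<tau>"
proof -
  have "(\<sigma> \<inter> \<tau>) \<inter> rel_interior \<sigma> \<noteq> {}" using assms(3) rel_interior_subset by blast
  then have "\<sigma> \<subseteq> \<sigma> \<inter> \<tau>" by (rule subset_of_face_of[OF Int_face_K[OF assms(1,2)] order_refl])
  then have "\<sigma> = \<tau> \<inter> \<sigma>" by blast
  then show ?thesis using Int_face_K[OF assms(2,1)] by simp
qed

lemma rel_interior_disjoint:
  assumes "\<sigma> \<in> K" "\<tau> \<in> K" "rel_interior \<sigma> \<inter> rel_interior \<tau> \<noteq> {}"
  shows "\<sigma> = \<tau>"
proof -
  have "rel_interior \<sigma> \<inter> \<tau> \<noteq> {}" "rel_interior \<tau> \<inter> \<sigma> \<noteq> {}"
    using assms(3) rel_interior_subset by blast+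
  then have "\<sigma> face_of \<tau>" "\<tau> face_of \<sigma>"
    using rel_interior_meets assms(1,2) by blast+
  then show ?thesis using face_of_imp_subset by blast
qed

lemma tile_P: "T \<in> P \<Longrightarrow> morse_tile T" "T \<in> P \<Longrightarrow> underlying T \<in> K"
  "T \<in> P \<Longrightarrow> tile_points T \<subseteq> rel_space K L"
  using tiling unfolding morse_tiling_def by blast+

lemma tile_eqI: "T \<in> P \<Longrightarrow> T' \<in> P \<Longrightarrow> tile_points T \<inter> tile_points T' \<noteq> {} \<Longrightarrow> T = T'"
  using tiling unfolding morse_tiling_def disjoint_family_on_def by blast

lemma rel_interior_meets_tile:
  assumes T: "T \<in> P" and \<sigma>: "\<sigma> \<in> K" "rel_interior \<sigma> \<inter> tile_points T \<noteq> {}"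
  shows "\<sigma> \<in> tile_simplices T"
proof -
  have "rel_interior \<sigma> \<inter> underlying T \<noteq> {}" using \<sigma>(2) by (auto simp: tile_points_def)
  then have "\<sigma> face_of underlying T" using rel_interior_meets[OF \<sigma>(1) tile_P(2)[OF T]] by simp
  moreover have "\<sigma> \<inter> tile_points T \<noteq> {}" using \<sigma>(2) rel_interior_subset by blast
  ultimately show ?thesis by (simp add: tile_simplices_iff)
qed

text \<open>That \<open>\<sigma>\<close> is not in \<open>L\<close> is seen at a point of its
  interior: this point lies in some open simplex of \<open>K - L\<close>, and open simplices of
  \<open>K\<close> are disjoint.\<close>

lemma tile_simplices_D:
  assumes T: "T \<in> P" and \<sigma>: "\<sigma> \<in> tile_simplices T"
  shows "\<sigma> \<in> K" "\<sigma> \<notin> L" "\<sigma> \<noteq> {}" "rel_interior \<sigma> \<subseteq> tile_points T" "rel_interior \<sigma> \<noteq> {}"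
proof -
  have face: "\<sigma> face_of underlying T" using \<sigma> by (simp add: tile_simplices_iff)
  show K: "\<sigma> \<in> K" using face_K[OF tile_P(2)[OF T] face] .
  show ne: "\<sigma> \<noteq> {}" using \<sigma> by (auto simp: tile_simplices_iff)
  show ri: "rel_interior \<sigma> \<subseteq> tile_points T"
    by (rule tile_simplices_rel_interior[OF tile_P(1)[OF T] face \<sigma>])
  show "rel_interior \<sigma> \<noteq> {}" using rel_interior_nonempty[OF K ne] .
  then obtain x where x: "x \<in> rel_interior \<sigma>" by blast
  then have "x \<in> rel_space K L" using ri tile_P(3)[OF T] by blast
  then obtain \<tau> where "\<tau> \<in> K - L" "x \<in> rel_interior \<tau>" by (auto simp: rel_space_def)
  then show "\<sigma> \<notin> L" using rel_interior_disjoint[OF K] x by blast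
qed

lemma tile_points_nonempty: "T \<in> P \<Longrightarrow> tile_points T \<noteq> {}"
  using tile_simplices_D[OF _ underlying_in_tile_simplices] tile_P(1) by blast

lemma Aq_iff: "\<sigma> \<in> Aq \<longleftrightarrow> \<sigma> \<in> K \<and> \<sigma> \<notin> L \<and> aff_dim \<sigma> \<le> int q"
  by (auto simp: Aq_def skeleton_def)

lemma simplex_family_Aq: "simplex_family K \<nu> Aq"
proof (unfold_locales)
  fix \<rho> \<sigma> \<tau> assume a: "\<rho> \<in> Aq" "\<sigma> \<in> Aq" "\<rho> facet_of \<tau>" "\<tau> facet_of \<sigma>"
  have "\<rho> face_of \<tau>" "\<tau> face_of \<sigma>" "aff_dim \<tau> \<le> aff_dim \<sigma>"
    using a by (auto simp: facet_of_def)
  then show "\<tau> \<in> Aq" using a(1,2) face_K[of \<sigma> \<tau>] face_L[of \<tau> \<rho>] by (auto simp: Aq_iff)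
qed (auto simp: K \<nu> Aq_iff)

lemma simplex_family_tile:
  assumes T: "T \<in> P" shows "simplex_family K \<nu> (tile_simplices T)"
proof (unfold_locales)
  fix \<rho> \<sigma> \<tau> assume a: "\<rho> \<in> tile_simplices T" "\<sigma> \<in> tile_simplices T" "\<rho> facet_of \<tau>" "\<tau> facet_of \<sigma>"
  have "\<rho> \<subseteq> \<tau>" "\<tau> face_of \<sigma>" using a by (auto simp: facet_of_def dest: face_of_imp_subset)
  then show "\<tau> \<in> tile_simplices T"
    using a(1,2) face_of_trans[of \<tau> \<sigma> "underlying T"] by (auto simp: tile_simplices_iff)
qed (use K \<nu> tile_simplices_D(1)[OF T] in auto)

section \<open>The steps of the shelling and the tiles that they add\<close>

lemma
  shows S_0: "S 0 = {}"
    and S_Suc: "j < N \<Longrightarrow> S j \<subseteq> S (Suc j)"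
    and S_tile: "j < N \<Longrightarrow> \<exists>T\<in>P. S (Suc j) - S j = tile_points T"
    and S_closed: "j \<le> N \<Longrightarrow> closedin (top_of_set (rel_space (skeleton q K) (skeleton q L)))
      (S j \<inter> rel_space (skeleton q K) (skeleton q L))"
    and S_N: "rel_space (skeleton q K) (skeleton q L) \<subseteq> S N"
proof -
  let ?Sq = "rel_space (skeleton q K) (skeleton q L)"
  have *: "S 0 = {}" "\<forall>j<N. S j \<subseteq> S (Suc j)"
    "\<forall>j<N. \<exists>T\<in>P. tile_order T \<le> q + 1 \<and> S (Suc j) - S j = tile_points T"
    "\<forall>j\<le>N. closedin (top_of_set ?Sq) (S j \<inter> ?Sq)" "S N \<inter> ?Sq = ?Sq"
    using shelling unfolding partial_shelling_def Let_def by - (elim conjE, assumption)+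
  show "S 0 = {}" by (rule *(1))
  show "j < N \<Longrightarrow> S j \<subseteq> S (Suc j)" using *(2) by simp
  show "j < N \<Longrightarrow> \<exists>T\<in>P. S (Suc j) - S j = tile_points T" using *(3) by meson
  show "j \<le> N \<Longrightarrow> closedin (top_of_set ?Sq) (S j \<inter> ?Sq)" using *(4) by simp
  show "?Sq \<subseteq> S N" using *(5) by (simp only: inf.absorb_iff2)
qed

lemma S_mono: "i \<le> j \<Longrightarrow> j \<le> N \<Longrightarrow> S i \<subseteq> S j"
proof (induction j rule: dec_induct)
  case (step j)
  then show ?case using S_Suc[of j] by auto
qed simp

lemma tile_at_exists:
  assumes "1 \<le> p" "p \<le> int N"
  shows "\<exists>T\<in>P. tile_points T = S (nat p) - S (nat p - 1)"
proof -
  have "nat p - 1 < N" "Suc (nat p - 1) = nat p" using assms by auto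
  then show ?thesis using S_tile[of "nat p - 1"] by metis
qed

text \<open>For \<open>1 \<le> p \<le> N\<close> the choice is unique, because tiles are non-empty
  and distinct ones are disjoint; outside this range nothing is claimed about it.\<close>

definition tile_at :: "int \<Rightarrow> 'a tile" where
  "tile_at p = (SOME T. T \<in> P \<and> tile_points T = S (nat p) - S (nat p - 1))"

lemma tile_at:
  assumes "1 \<le> p" "p \<le> int N"
  shows "tile_at p \<in> P" "tile_points (tile_at p) = S (nat p) - S (nat p - 1)"
proof -
  have "\<exists>T. T \<in> P \<and> tile_points T = S (nat p) - S (nat p - 1)"
    using tile_at_exists[OF assms] by blast
  from someI_ex[OF this]
  show "tile_at p \<in> P" "tile_points (tile_at p) = S (nat p) - S (nat p - 1)"
    unfolding tile_at_def by blast+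
qed

text \<open>What is added at a later step is disjoint from the earlier steps, and a tile is not
  empty.\<close>

lemma inj_on_tile_at: "inj_on tile_at {1..int N}"
proof -
  have "tile_at p \<noteq> tile_at p'" if p: "1 \<le> p" "p < p'" "p' \<le> int N" for p p'
  proof
    assume eq: "tile_at p = tile_at p'"
    have "S (nat p) \<subseteq> S (nat p' - 1)" using p by (intro S_mono) auto
    then have "tile_points (tile_at p) \<inter> tile_points (tile_at p') = {}"
      using tile_at(2)[of p] tile_at(2)[of p'] p by auto
    then show False using eq tile_points_nonempty[OF tile_at(1)[of p]] p by auto
  qed
  then show ?thesis by (intro linorder_inj_onI') auto
qed

lemma critical_tiles_at_eq:
  "critical_tiles_at P N S p = (if 1 \<le> p \<and> p \<le> int N \<and> critical (tile_at p) then {tile_at p} else {})"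
proof -
  have "T = tile_at p" if "1 \<le> p" "p \<le> int N" "T \<in> P" "tile_points T = S (nat p) - S (nat p - 1)" for T
    using tile_eqI[OF that(3) tile_at(1)[OF that(1,2)]] tile_points_nonempty[OF that(3)]
      tile_at(2)[OF that(1,2)] that(4) by simp
  then show ?thesis using tile_at[of p] by (auto simp: critical_tiles_at_def)
qed

lemma S_N_tiles: "x \<in> S N \<Longrightarrow> \<exists>p\<in>{1..int N}. x \<in> tile_points (tile_at p)"
proof -
  have "x \<in> S j \<Longrightarrow> \<exists>p\<in>{1..int N}. x \<in> tile_points (tile_at p)" if "j \<le> N" for j
    using that
  proof (induction j)
    case (Suc j)
    show ?case
    proof (cases "x \<in> S j")
      case False
      have "tile_points (tile_at (int (Suc j))) = S (Suc j) - S j"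
        using tile_at(2)[of "int (Suc j)"] Suc.prems by (simp del: of_nat_Suc)
      then have "x \<in> tile_points (tile_at (int (Suc j)))" using False Suc.prems by simp
      then show ?thesis using Suc.prems by (intro bexI[of _ "int (Suc j)"]) auto
    qed (use Suc in auto)
  qed (simp add: S_0)
  then show "x \<in> S N \<Longrightarrow> ?thesis" by blast
qed

section \<open>The families of simplices of the filtration\<close>

lemma Aq_rel_interior: "\<sigma> \<in> Aq \<Longrightarrow> rel_interior \<sigma> \<subseteq> rel_space (skeleton q K) (skeleton q L)"
  by (auto simp: Aq_def rel_space_def)

lemma SS_iff: "\<sigma> \<in> SS p \<longleftrightarrow> \<sigma> \<in> Aq \<and> rel_interior \<sigma> \<subseteq> S (min N (nat p))"
  by (simp add: shelling_simplices_def Aq_def)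

lemma SS_mono:
  assumes "p \<le> p'" shows "SS p \<subseteq> SS p'"
proof -
  have "S (min N (nat p)) \<subseteq> S (min N (nat p'))" using assms by (intro S_mono) auto
  then show ?thesis unfolding SS_iff subset_iff by blast
qed

text \<open>The empty simplex may survive in every step, its relative interior being empty; chains
  ignore it.\<close>

lemma SS_low:
  assumes "p \<le> 0" "\<sigma> \<in> SS p" shows "\<sigma> = {}"
proof (rule ccontr)
  assume "\<sigma> \<noteq> {}"
  then have "rel_interior \<sigma> \<noteq> {}" using assms rel_interior_nonempty by (simp add: SS_iff Aq_iff)
  then show False using assms by (simp add: SS_iff S_0)
qed

lemma SS_high:
  assumes "int N \<le> p" shows "SS p = Aq"
proof -
  have m: "min N (nat p) = N" using assms by simp
  show ?thesis unfolding set_eq_iff SS_iff m using Aq_rel_interior S_N by blast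
qed

lemma SS_step_outside:
  assumes "\<not> (1 \<le> p \<and> p \<le> int N)" shows "SS (p - 1) = SS p"
proof -
  have m: "min N (nat (p - 1)) = min N (nat p)" using assms by auto
  show ?thesis unfolding set_eq_iff SS_iff m by simp
qed

text \<open>An open simplex of \<open>K\<close> lies in a tile or misses it, so a simplex enters the
  filtration as a whole when its tile is added. The dimension bound is needed because the tile may
  also have simplices outside the skeleton.\<close>

lemma SS_step:
  assumes p: "1 \<le> p" "p \<le> int N" and \<sigma>: "\<sigma> \<noteq> {}" "aff_dim \<sigma> \<le> int q"
  shows "\<sigma> \<in> tile_simplices (tile_at p) \<longleftrightarrow> \<sigma> \<in> SS p - SS (p - 1)"
proof -
  note t = tile_at[OF p]
  have m: "min N (nat p) = nat p" "min N (nat (p - 1)) = nat p - 1" using p by auto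
  show ?thesis
  proof
    assume ts: "\<sigma> \<in> tile_simplices (tile_at p)"
    note d = tile_simplices_D[OF t(1) ts]
    show "\<sigma> \<in> SS p - SS (p - 1)"
      using d \<sigma> t(2) unfolding Diff_iff SS_iff Aq_iff m by blast
  next
    assume "\<sigma> \<in> SS p - SS (p - 1)"
    then have "\<sigma> \<in> K" "rel_interior \<sigma> \<inter> tile_points (tile_at p) \<noteq> {}"
      using t(2) unfolding Diff_iff SS_iff Aq_iff m by blast+
    then show "\<sigma> \<in> tile_simplices (tile_at p)" using rel_interior_meets_tile[OF t(1)] by blast
  qed
qed

text \<open>A simplex is the closure of its relative interior, so a closed set \<open>C\<close>
  cutting out the step in the skeleton contains the facets as well.\<close>

lemma SS_facet:
  assumes \<tau>: "\<tau> \<in> Aq" and facet: "\<tau> facet_of \<sigma>" and \<sigma>: "\<sigma> \<in> SS p"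
  shows "\<tau> \<in> SS p"
proof -
  let ?Sq = "rel_space (skeleton q K) (skeleton q L)" and ?m = "min N (nat p)"
  obtain C where C: "closed C" "S ?m \<inter> ?Sq = ?Sq \<inter> C"
    using S_closed[of ?m] by (auto simp: closedin_closed)
  have "\<sigma> \<in> K" using \<sigma> by (simp add: SS_iff Aq_iff)
  then obtain n where n: "n simplex \<sigma>" using simplex_K by blast
  have "rel_interior \<sigma> \<subseteq> C"
    using \<sigma> C(2) Aq_rel_interior[of \<sigma>] unfolding SS_iff by blast
  then have "closure (rel_interior \<sigma>) \<subseteq> C" using C(1) by (rule closure_minimal)
  then have "\<sigma> \<subseteq> C"
    using convex_closure_rel_interior[OF convex_simplex[OF n]] closure_subset by blast
  moreover have "\<tau> \<subseteq> \<sigma>" using facet by (auto simp: facet_of_def dest: face_of_imp_subset)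
  ultimately have "rel_interior \<tau> \<subseteq> C" using rel_interior_subset by blast
  then show ?thesis
    using \<tau> Aq_rel_interior[OF \<tau>] C(2) unfolding SS_iff by blast
qed

text \<open>A critical tile which is not part of the shelling thus has no homology in degrees below \<open>q\<close>, and
  does not contribute to the sum over all critical tiles.\<close>

lemma tile_outside_shelling:
  assumes T: "T \<in> P" "T \<notin> tile_at ` {1..int N}" and \<sigma>: "\<sigma> \<in> tile_simplices T"
  shows "int q < aff_dim \<sigma>"
proof (rule ccontr)
  assume "\<not> int q < aff_dim \<sigma>"
  note d = tile_simplices_D[OF T(1) \<sigma>]
  have "\<sigma> \<in> Aq" using d \<open>\<not> int q < aff_dim \<sigma>\<close> by (simp add: Aq_iff)
  then have "rel_interior \<sigma> \<subseteq> S N" using Aq_rel_interior S_N by blast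
  moreover obtain x where "x \<in> rel_interior \<sigma>" using d(5) by blast
  ultimately obtain p where p: "p \<in> {1..int N}" "x \<in> tile_points (tile_at p)" and "x \<in> tile_points T"
    using S_N_tiles d(4) by blast
  then have "T = tile_at p" using tile_eqI[OF T(1) tile_at(1)[of p]] by auto
  then show False using T(2) p(1) by blast
qed

text \<open>Both claims are reindexings along \<open>tile_at\<close>. Steps outside the range or
  with a tile that is not critical give trivial terms on the side of the page, and critical tiles
  left out of the shelling give trivial terms on the side of the tiles.\<close>

lemma page_of_critical_tilesI:
  assumes E1: "\<And>p n. n < int q \<Longrightarrow> group (E1 p (n - p))"
    and h: "\<And>T n. T \<in> P \<Longrightarrow> group (h T n)"
    and iso: "\<And>p n. n < int q \<Longrightarrow> 1 \<le> p \<Longrightarrow> p \<le> int N \<Longrightarrow> E1 p (n - p) \<cong> h (tile_at p) n"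
    and outside: "\<And>p n. n < int q \<Longrightarrow> \<not> (1 \<le> p \<and> p \<le> int N) \<Longrightarrow> trivial_group (E1 p (n - p))"
    and noncritical: "\<And>T n. T \<in> P \<Longrightarrow> \<not> critical T \<Longrightarrow> trivial_group (h T n)"
    and unused: "\<And>T n. n < int q \<Longrightarrow> T \<in> P \<Longrightarrow> T \<notin> tile_at ` {1..int N} \<Longrightarrow> trivial_group (h T n)"
  shows "page_of_critical_tiles P q N S E1 h"
  unfolding page_of_critical_tiles_def
proof (intro allI impI conjI)
  fix n p :: int assume n: "n < int q"
  let ?C = "{p \<in> {1..int N}. critical (tile_at p)}"
  have E1_trivial: "trivial_group (E1 p (n - p))" if "p \<notin> ?C" for p
  proof (cases "1 \<le> p \<and> p \<le> int N")
    case True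
    then have "\<not> critical (tile_at p)" using that by auto
    then have "trivial_group (h (tile_at p) n)" using noncritical tile_at(1) True by blast
    then show ?thesis
      using isomorphic_group_triviality[OF iso[OF n] E1[OF n] h[OF tile_at(1)]] True by blast
  qed (use outside[OF n] in blast)
  have iso': "E1 p (n - p) \<cong> h (tile_at p) n" if "p \<in> ?C" for p
    using that iso[OF n] by auto
  have crit_P: "critical_tiles_at P N S p \<subseteq> P" by (auto simp: critical_tiles_at_def)
  have "E1 p (n - p) \<cong> sum_group {p} (\<lambda>p. E1 p (n - p))"
    by (rule sum_group_singleton[where H = "\<lambda>p. E1 p (n - p)", OF E1[OF n]])
  also have "sum_group {p} (\<lambda>p. E1 p (n - p)) \<cong> sum_group (critical_tiles_at P N S p) (\<lambda>T. h T n)"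
  proof (rule sum_group_iso_reindex[where ?I0.0 = "{p} \<inter> ?C" and ?J0.0 = "critical_tiles_at P N S p" and \<pi> = tile_at])
    show "bij_betw tile_at ({p} \<inter> ?C) (critical_tiles_at P N S p)"
      unfolding critical_tiles_at_eq by (auto simp: bij_betw_def)
    show "trivial_group (E1 i (n - i))" if "i \<in> {p} - ({p} \<inter> ?C)" for i
      using that by (intro E1_trivial) blast
    show "E1 i (n - i) \<cong> h (tile_at i) n" if "i \<in> {p} \<inter> ?C" for i
      using that by (intro iso') blast
  qed (use E1[OF n] h crit_P in auto)
  finally show "E1 p (n - p) \<cong> sum_group (critical_tiles_at P N S p) (\<lambda>T. h T n)" .
  show "sum_group UNIV (\<lambda>p. E1 p (n - p)) \<cong> sum_group {T \<in> P. critical T} (\<lambda>T. h T n)"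
  proof (rule sum_group_iso_reindex[where ?I0.0 = ?C and ?J0.0 = "tile_at ` ?C" and \<pi> = tile_at])
    show "tile_at ` ?C \<subseteq> {T \<in> P. critical T}" using tile_at(1) by auto
    show "bij_betw tile_at ?C (tile_at ` ?C)"
      using inj_on_tile_at by (auto simp: bij_betw_def intro: inj_on_subset)
    show "trivial_group (E1 i (n - i))" if "i \<in> UNIV - ?C" for i
      using that by (intro E1_trivial) blast
    show "E1 i (n - i) \<cong> h (tile_at i) n" if "i \<in> ?C" for i
      using that by (intro iso')
    show "trivial_group (h T n)" if "T \<in> {T \<in> P. critical T} - tile_at ` ?C" for T
      using that by (intro unused[OF n]) auto
  qed (use E1[OF n] h in auto)
qed

section \<open>The homological and the cohomological spectral sequence\<close>

lemma boundary_filtration: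
  "filtered_incidence (-1) (\<lambda>\<tau> \<sigma>. \<tau> facet_of \<sigma>) (\<lambda>\<tau> \<sigma>. omitted_position \<nu> \<sigma> \<tau>) Aq
    (simplicial_boundary \<nu> Aq :: ('a set \<Rightarrow> 'g::ab_group_add) \<Rightarrow> _) SS"
proof (intro filtered_incidence.intro filtered_incidence_axioms.intro)
  show "SS p \<subseteq> Aq" "SS (p + - 1) \<subseteq> SS p" for p
    using SS_mono[of "p - 1" p] by (auto simp: SS_iff)
qed (use SS_facet in \<open>auto intro: simplex_family.incidence_boundary[OF simplex_family_Aq]\<close>)

text \<open>The complement of a family closed under facets is stable under the coboundary. The shift
  to \<open>p - 1\<close> makes the graded piece at \<open>p\<close> belong to the same tile as in
  homology.\<close>

lemma coboundary_filtration:
  "filtered_incidence 1 (\<lambda>\<sigma> \<tau>. \<tau> facet_of \<sigma>) (\<lambda>\<sigma> \<tau>. omitted_position \<nu> \<sigma> \<tau>) Aq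
    (simplicial_coboundary \<nu> Aq :: ('a set \<Rightarrow> 'g::ab_group_add) \<Rightarrow> _) (\<lambda>p. Aq - SS (p - 1))"
proof (intro filtered_incidence.intro filtered_incidence_axioms.intro)
  show "Aq - SS (p + 1 - 1) \<subseteq> Aq - SS (p - 1)" for p
    using SS_mono[of "p - 1" p] by auto
qed (use SS_facet in \<open>auto intro: simplex_family.incidence_coboundary[OF simplex_family_Aq]\<close>)

lemma homology_spectral_sequence:
  fixes G :: "'g::ab_group_add itself"
  defines "E \<equiv> homology_page G \<nu> K L q N S" and "d \<equiv> homology_diff G \<nu> K L q N S"
  shows "spectral_sequence (-1) E d"
    and "converges_to (-1) E d (simplicial_homology G \<nu> (skeleton q K) (skeleton q L))"
    and "page_of_critical_tiles P q N S (E 1) (tile_homology G \<nu>)"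
proof -
  let ?D = "simplicial_boundary \<nu> Aq :: ('a set \<Rightarrow> 'g) \<Rightarrow> _"
  interpret f: filtered_incidence "-1" "\<lambda>\<tau> \<sigma>. \<tau> facet_of \<sigma>" "\<lambda>\<tau> \<sigma>. omitted_position \<nu> \<sigma> \<tau>" Aq ?D SS
    by (rule boundary_filtration)
  have E: "E = f.E" and d: "d = f.d"
    unfolding E_def d_def homology_page_def homology_diff_def Aq_def chain_filtration_def[abs_def] by simp_all
  show "spectral_sequence (-1) E d" unfolding E d by (rule f.spectral_sequence_filtration)
  have H: "simplicial_homology G \<nu> (skeleton q K) (skeleton q L) = f.H"
    unfolding simplicial_homology_def Aq_def ..
  show "converges_to (-1) E d (simplicial_homology G \<nu> (skeleton q K) (skeleton q L))"
    unfolding E d H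
  proof (rule f.converges_to_homology)
    fix p
    have "simplicial_chains (SS (p + - 1 * int r)) n = ({0} :: ('a set \<Rightarrow> 'g) set)" if "nat p \<le> r" for r n
      using SS_low[of "p + - 1 * int r"] that by (intro simplicial_chains_trivial) auto
    then show "\<exists>r0. \<forall>r\<ge>r0. \<forall>n. simplicial_chains (SS (p + - 1 * int r)) n = ({0} :: ('a set \<Rightarrow> 'g) set)"
      by blast
    \<comment> \<open>Since \<open>e = -1\<close>, subtracting \<open>e * r\<close> raises the index
      to \<open>p + r\<close>, which must reach \<open>N\<close>.\<close>
    have "SS (p - - 1 * int r) = Aq" if "nat (int N - p) \<le> r" for r
      using that by (intro SS_high) auto
    then show "\<exists>r0. \<forall>r\<ge>r0. \<forall>n. simplicial_chains (SS (p - - 1 * int r)) n = (simplicial_chains Aq n :: ('a set \<Rightarrow> 'g) set)"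
      by metis
  qed
  have T: "incidence (-1) (\<lambda>\<tau> \<sigma>. \<tau> facet_of \<sigma>) (\<lambda>\<tau> \<sigma>. omitted_position \<nu> \<sigma> \<tau>) (tile_simplices T)
      (simplicial_boundary \<nu> (tile_simplices T) :: ('a set \<Rightarrow> 'g) \<Rightarrow> _)" if "T \<in> P" for T
    by (rule simplex_family.incidence_boundary[OF simplex_family_tile[OF that]])
  have h: "tile_homology G \<nu> T = homology_of_complex (-1) (simplicial_chains (tile_simplices T))
      (simplicial_boundary \<nu> (tile_simplices T) :: ('a set \<Rightarrow> 'g) \<Rightarrow> _)" for T
    unfolding tile_homology_def simplicial_homology_def tile_simplices_def ..
  show "page_of_critical_tiles P q N S (E 1) (tile_homology G \<nu>)"
  proof (rule page_of_critical_tilesI)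
    fix p n :: int assume n: "n < int q"
    show "group (E 1 p (n - p))" unfolding E using f.comm_group_page[of 1] by (simp add: comm_group_def)
    show "E 1 p (n - p) \<cong> tile_homology G \<nu> (tile_at p) n" if "1 \<le> p" "p \<le> int N"
      unfolding E h using SS_step[OF that] by (intro f.first_page_iso[OF T[OF tile_at(1)[OF that]] _ n]) simp_all
    show "trivial_group (E 1 p (n - p))" if "\<not> (1 \<le> p \<and> p \<le> int N)"
      unfolding E using SS_step_outside[OF that] by (intro f.first_page_trivial[OF _ _ n]) auto
    show "trivial_group (tile_homology G \<nu> T n)" if "T \<in> P" "T \<notin> tile_at ` {1..int N}" for T
      unfolding h using tile_outside_shelling[OF that] n
      by (intro incidence.trivial_group_H_no_simplices[OF T[OF that(1)]]) force
  next
    fix T n assume TP: "T \<in> P"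
    show "group (tile_homology G \<nu> T n)"
      unfolding h using incidence.comm_group_H[OF T[OF TP]] by (simp add: comm_group_def)
    show "trivial_group (tile_homology G \<nu> T n)" if "\<not> critical T"
      using noncritical_tile_homology(1)[OF tile_P(1)[OF TP] that simplex_family_tile[OF TP]]
      unfolding tile_homology_def simplicial_homology_def .
  qed
qed

lemma cohomology_spectral_sequence:
  fixes G :: "'g::ab_group_add itself"
  defines "E \<equiv> cohomology_page G \<nu> K L q N S" and "d \<equiv> cohomology_diff G \<nu> K L q N S"
  shows "spectral_sequence 1 E d"
    and "converges_to 1 E d (simplicial_cohomology G \<nu> (skeleton q K) (skeleton q L))"
    and "page_of_critical_tiles P q N S (E 1) (tile_cohomology G \<nu>)"
proof -
  let ?D = "simplicial_coboundary \<nu> Aq :: ('a set \<Rightarrow> 'g) \<Rightarrow> _"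
  interpret f: filtered_incidence 1 "\<lambda>\<sigma> \<tau>. \<tau> facet_of \<sigma>" "\<lambda>\<sigma> \<tau>. omitted_position \<nu> \<sigma> \<tau>" Aq ?D
      "\<lambda>p. Aq - SS (p - 1)"
    by (rule coboundary_filtration)
  have E: "E = f.E" and d: "d = f.d"
    unfolding E_def d_def cohomology_page_def cohomology_diff_def Aq_def cochain_filtration_def[abs_def]
    by simp_all
  show "spectral_sequence 1 E d" unfolding E d by (rule f.spectral_sequence_filtration)
  have H: "simplicial_cohomology G \<nu> (skeleton q K) (skeleton q L) = f.H"
    unfolding simplicial_cohomology_def Aq_def ..
  show "converges_to 1 E d (simplicial_cohomology G \<nu> (skeleton q K) (skeleton q L))"
    unfolding E d H
  proof (rule f.converges_to_homology)
    fix p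
    have "simplicial_chains (Aq - SS (p + 1 * int r - 1)) n = ({0} :: ('a set \<Rightarrow> 'g) set)"
      if "nat (int N - p + 1) \<le> r" for r n
      using SS_high[of "p + 1 * int r - 1"] that by (intro simplicial_chains_trivial) auto
    then show "\<exists>r0. \<forall>r\<ge>r0. \<forall>n. simplicial_chains (Aq - SS (p + 1 * int r - 1)) n = ({0} :: ('a set \<Rightarrow> 'g) set)"
      by blast
    \<comment> \<open>At most the empty simplex is taken out of \<open>Aq\<close> here, so the
      families may differ while the cochains do not.\<close>
    have "simplicial_chains (Aq - SS (p - 1 * int r - 1)) n = (simplicial_chains Aq n :: ('a set \<Rightarrow> 'g) set)"
      if "nat p \<le> r" for r n
      using SS_low[of "p - 1 * int r - 1"] that by (intro simplicial_chains_cong) (auto simp: nat_le_iff)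
    then show "\<exists>r0. \<forall>r\<ge>r0. \<forall>n. simplicial_chains (Aq - SS (p - 1 * int r - 1)) n = (simplicial_chains Aq n :: ('a set \<Rightarrow> 'g) set)"
      by blast
  qed
  have T: "incidence 1 (\<lambda>\<sigma> \<tau>. \<tau> facet_of \<sigma>) (\<lambda>\<sigma> \<tau>. omitted_position \<nu> \<sigma> \<tau>) (tile_simplices T)
      (simplicial_coboundary \<nu> (tile_simplices T) :: ('a set \<Rightarrow> 'g) \<Rightarrow> _)" if "T \<in> P" for T
    by (rule simplex_family.incidence_coboundary[OF simplex_family_tile[OF that]])
  have h: "tile_cohomology G \<nu> T = homology_of_complex 1 (simplicial_chains (tile_simplices T))
      (simplicial_coboundary \<nu> (tile_simplices T) :: ('a set \<Rightarrow> 'g) \<Rightarrow> _)" for T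
    unfolding tile_cohomology_def simplicial_cohomology_def tile_simplices_def ..
  show "page_of_critical_tiles P q N S (E 1) (tile_cohomology G \<nu>)"
  proof (rule page_of_critical_tilesI)
    fix p n :: int assume n: "n < int q"
    show "group (E 1 p (n - p))" unfolding E using f.comm_group_page[of 1] by (simp add: comm_group_def)
    show "E 1 p (n - p) \<cong> tile_cohomology G \<nu> (tile_at p) n" if "1 \<le> p" "p \<le> int N"
    proof -
      \<comment> \<open>Taking complements reverses the inclusion, so the graded piece is again
        \<open>SS p - SS (p - 1)\<close>.\<close>
      have "\<sigma> \<in> tile_simplices (tile_at p) \<longleftrightarrow> \<sigma> \<in> (Aq - SS (p - 1)) - (Aq - SS (p + 1 - 1))"
        if "\<sigma> \<noteq> {}" "aff_dim \<sigma> \<le> int q" for \<sigma>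
        using SS_step[OF \<open>1 \<le> p\<close> \<open>p \<le> int N\<close> that] by (auto simp: SS_iff)
      then show ?thesis
        unfolding E h by (intro f.first_page_iso[OF T[OF tile_at(1)[OF that]] _ n]) simp_all
    qed
    show "trivial_group (E 1 p (n - p))" if "\<not> (1 \<le> p \<and> p \<le> int N)"
      unfolding E using SS_step_outside[OF that] by (intro f.first_page_trivial[OF _ _ n]) auto
    show "trivial_group (tile_cohomology G \<nu> T n)" if "T \<in> P" "T \<notin> tile_at ` {1..int N}" for T
      unfolding h using tile_outside_shelling[OF that] n
      by (intro incidence.trivial_group_H_no_simplices[OF T[OF that(1)]]) force
  next
    fix T n assume TP: "T \<in> P"
    show "group (tile_cohomology G \<nu> T n)"
      unfolding h using incidence.comm_group_H[OF T[OF TP]] by (simp add: comm_group_def)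
    show "trivial_group (tile_cohomology G \<nu> T n)" if "\<not> critical T"
      using noncritical_tile_homology(2)[OF tile_P(1)[OF TP] that simplex_family_tile[OF TP]]
      unfolding tile_cohomology_def simplicial_cohomology_def .
  qed
qed

end

theorem theorem4p1:
  fixes K L :: "'a::euclidean_space set set"
    and P :: "'a tile set"
    and q N :: nat
    and S :: "nat \<Rightarrow> 'a set"
    and \<nu> :: "'a \<Rightarrow> nat"
  assumes "simplicial_complex K" and "simplicial_complex L" and "L \<subseteq> K"
    and "morse_tiling K L P"
    and "acyclic (quiver K L P q)"
    and "partial_shelling K L P q N S"
    and "inj_on \<nu> {v. {v} \<in> K}"
  shows
    "(let E = homology_page TYPE('g::ab_group_add) \<nu> K L q N S;
          d = homology_diff TYPE('g) \<nu> K L q N S in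
        spectral_sequence (-1) E d \<and>
        converges_to (-1) E d (simplicial_homology TYPE('g) \<nu> (skeleton q K) (skeleton q L)) \<and>
        page_of_critical_tiles P q N S (E 1) (tile_homology TYPE('g) \<nu>)) \<and>
     (let E = cohomology_page TYPE('g) \<nu> K L q N S;
          d = cohomology_diff TYPE('g) \<nu> K L q N S in
        spectral_sequence 1 E d \<and>
        converges_to 1 E d (simplicial_cohomology TYPE('g) \<nu> (skeleton q K) (skeleton q L)) \<and>
        page_of_critical_tiles P q N S (E 1) (tile_cohomology TYPE('g) \<nu>))"
proof -
  interpret morse_shelling K L P q N S \<nu>
    using assms by unfold_locales
  show ?thesis
    unfolding Let_def
    by (intro conjI homology_spectral_sequence cohomology_spectral_sequence)
qed

end
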